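(* Let $V$ be a rank one valuation domain with quotient field $K$ and valuation $v$, and let $E=\{s_n\}_{n\in\mathbb{N}}\subset K$ be a pseudo-convergent sequence. (a) If $E$ is of transcendental type, then $V_E=W_E$ has rank $1$. (b) If $E$ is of algebraic type and its breadth is infinite, then $V_E$ has rank $2$; furthermore, if $q\in K[X]$ is the minimal polynomial over $K$ of the pseudo-limit of $E$, then the one-dimensional overring of $V_E$ is $K[X]_{(q)}$. (c) Suppose that $E$ is of algebraic type with breadth $\delta\in\mathbb{R}$. The following conditions are equivalent: (i) $\delta$ is not torsion over $\Gamma_v$; (ii) $W_E$ is not residually transcendental over $V$; (iii) $V_E$ has rank one; (iv) $V_E=W_E$; (v) $V_E\cap K[X]=W_E\cap K[X]$.
   Context: $V$ has rank one and its value group $\Gamma_v$ is regarded as a subgroup of $\mathbb{R}$. A sequence $E=\{s_n\}_{n\in\mathbb{N}}$ in $K$ is pseudo-convergent if $v(s_{n+1}-s_n)<v(s_{n+2}-s_{n+1})$ for all $n$. Its breadth is $\delta=\lim_{n\to\infty}v(s_{n+1}-s_n)\in\mathbb{R}\cup\{\infty\}$. $E$ is of transcendental type if $v(f(s_n))$ is eventually constant for every $f\in K[X]$, and of algebraic type if $v(f(s_n))$ is eventually strictly increasing for some $f\in K[X]$. If the breadth of $E$ is infinite, $E$ is a Cauchy sequence converging to a unique element of the completion $\widehat{K}$ of $K$ (with respect to the topology induced by $v$), which is its unique pseudo-limit; this element is algebraic over $K$ when $E$ is of algebraic type. $V_E=\{\phi\in K(X)\mid \phi(s_n)\in V\text{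 for all but finitely many }n\in\mathbb{N}\}$, a valuation domain of $K(X)$ lying over $V$. If $E$ is of transcendental type, or of algebraic type with finite breadth, the map $w_E(\phi)=\lim_{n\to\infty}v(\phi(s_n))$ is a rank one valuation on $K(X)$ extending $v$, and $W_E=\{\phi\in K(X)\mid w_E(\phi)\geq 0\}$ denotes its valuation domain. An element $\delta\in\mathbb{R}$ is torsion over $\Gamma_v$ if $k\delta\in\Gamma_v$ for some integer $k\geq 1$. A valuation domain $W$ of $K(X)$ lying over $V$ is residually transcendental over $V$ if the residue field of $W$ is a transcendental extension of the residue field of $V$. *)

theory Defs
  imports
    Complex_Main
    "HOL-Library.Extended_Real"
    "HOL-Library.Extended_Nat"
    "HOL-Computational_Algebra.Polynomial"
    "HOL-Computational_Algebra.Fraction_Field"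
    "HOL-Algebra.QuotRing"
    "HOL-Algebra.Subrings"
    "HOL-Algebra.Finite_Extensions"
begin

text \<open>
  A field is a type of class \<open>field\<close>; the rational function field \<open>K(X)\<close> over \<open>'a\<close>
  is \<open>'a poly fract\<close>. Subrings of fields are sets; they are turned into HOL-Algebra records by
  \<open>ring_on\<close>, so that ideals, quotients and transcendence are those of HOL-Algebra.
\<close>

definition ring_on :: "'a::comm_ring_1 set \<Rightarrow> 'a ring" where
  "ring_on A = \<lparr>carrier = A, monoid.mult = (*), one = 1, zero = 0, add = (+)\<rparr>"

text \<open>The rank of a valuation domain is its Krull dimension.\<close>

definition krull_dim :: "('a, 'b) ring_scheme \<Rightarrow> enat" where
  "krull_dim R = Sup {enat n | n.
     \<exists>P. (\<forall>i\<le>n. primeideal (P i) R) \<and> (\<forall>i<n. P i \<subset> P (Suc i))}"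

definition rank :: "'a::field set \<Rightarrow> enat" where
  "rank W = krull_dim (ring_on W)"

text \<open>For a subring \<open>A\<close> of a field \<open>F\<close> that has quotient field \<open>F\<close>, these are the rings between
  \<open>A\<close> and its quotient field.\<close>

definition overrings :: "'a::field set \<Rightarrow> 'a set set" where
  "overrings A = {B. subring B (ring_on UNIV) \<and> A \<subseteq> B}"


section \<open>Rank one valuations\<close>

text \<open>A valuation has rank one iff its value group is a nonzero subgroup of the reals (up to
  order isomorphism); \<open>\<infinity>\<close> is the value of \<open>0\<close>.\<close>

locale rank_one_valuation =
  fixes v :: "'a::field \<Rightarrow> ereal"
  assumes v_not_MInf: "v x \<noteq> -\<infinity>"
    and v_eq_PInf_iff: "v x = \<infinity> \<longleftrightarrow> x = 0"
    and v_mult: "v (x * y) = v x + v y"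
    and v_add: "min (v x) (v y) \<le> v (x + y)"
    and v_nontrivial: "\<exists>x. x \<noteq> 0 \<and> v x \<noteq> 0"

definition valuation_ring :: "('a::field \<Rightarrow> ereal) \<Rightarrow> 'a set" where
  "valuation_ring v = {x. 0 \<le> v x}"

definition value_group :: "('a::field \<Rightarrow> ereal) \<Rightarrow> real set" where
  "value_group v = {\<gamma>. \<exists>x. x \<noteq> 0 \<and> v x = ereal \<gamma>}"

definition torsion_over :: "real set \<Rightarrow> real \<Rightarrow> bool" where
  "torsion_over \<Gamma> \<delta> \<longleftrightarrow> (\<exists>k\<ge>1::nat. real k * \<delta> \<in> \<Gamma>)"


section \<open>The completion\<close>

text \<open>Cauchy sequences modulo null sequences.\<close>

definition v_Cauchy :: "('a::field \<Rightarrow> ereal) \<Rightarrow> (nat \<Rightarrow> 'a) \<Rightarrow> bool" where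
  "v_Cauchy v t \<longleftrightarrow> (\<forall>r::real. \<exists>N. \<forall>m\<ge>N. \<forall>n\<ge>N. ereal r < v (t m - t n))"

definition null_seqs :: "('a::field \<Rightarrow> ereal) \<Rightarrow> (nat \<Rightarrow> 'a) set" where
  "null_seqs v = {t. (\<lambda>n. v (t n)) \<longlonglongrightarrow> \<infinity>}"

definition cauchy_ring :: "('a::field \<Rightarrow> ereal) \<Rightarrow> (nat \<Rightarrow> 'a) ring" where
  "cauchy_ring v = \<lparr>carrier = {t. v_Cauchy v t},
     monoid.mult = (\<lambda>s t n. s n * t n), one = (\<lambda>n. 1), zero = (\<lambda>n. 0),
     add = (\<lambda>s t n. s n + t n)\<rparr>"

definition completion :: "('a::field \<Rightarrow> ereal) \<Rightarrow> (nat \<Rightarrow> 'a) set ring" where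
  "completion v = cauchy_ring v Quot null_seqs v"

definition completion_embed :: "('a::field \<Rightarrow> ereal) \<Rightarrow> 'a \<Rightarrow> (nat \<Rightarrow> 'a) set" where
  "completion_embed v x = null_seqs v +>\<^bsub>cauchy_ring v\<^esub> (\<lambda>n. x)"

definition completion_val :: "('a::field \<Rightarrow> ereal) \<Rightarrow> (nat \<Rightarrow> 'a) set \<Rightarrow> ereal" where
  "completion_val v \<alpha> = (THE c. \<forall>t\<in>\<alpha>. (\<lambda>n. v (t n)) \<longlonglongrightarrow> c)"

definition completion_poly ::
    "('a::field \<Rightarrow> ereal) \<Rightarrow> 'a poly \<Rightarrow> (nat \<Rightarrow> 'a) set \<Rightarrow> (nat \<Rightarrow> 'a) set" where
  "completion_poly v p \<alpha> =
     (\<Oplus>\<^bsub>completion v\<^esub> i \<in> {..Polynomial.degree p}.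
        completion_embed v (Polynomial.coeff p i) \<otimes>\<^bsub>completion v\<^esub> (\<alpha> [^]\<^bsub>completion v\<^esub> i))"

definition is_minimal_polynomial ::
    "('a::field \<Rightarrow> ereal) \<Rightarrow> (nat \<Rightarrow> 'a) set \<Rightarrow> 'a poly \<Rightarrow> bool" where
  "is_minimal_polynomial v \<alpha> q \<longleftrightarrow>
     Polynomial.lead_coeff q = 1 \<and>
     completion_poly v q \<alpha> = \<zero>\<^bsub>completion v\<^esub> \<and>
     (\<forall>p. p \<noteq> 0 \<and> completion_poly v p \<alpha> = \<zero>\<^bsub>completion v\<^esub> \<longrightarrow>
        Polynomial.degree q \<le> Polynomial.degree p)"


section \<open>Pseudo-convergent sequences\<close>

definition pseudo_convergent :: "('a::field \<Rightarrow> ereal) \<Rightarrow> (nat \<Rightarrow> 'a) \<Rightarrow> bool" where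
  "pseudo_convergent v s \<longleftrightarrow>
     (\<forall>n. v (s (n + 1) - s n) < v (s (n + 2) - s (n + 1)))"

definition breadth :: "('a::field \<Rightarrow> ereal) \<Rightarrow> (nat \<Rightarrow> 'a) \<Rightarrow> ereal" where
  "breadth v s = lim (\<lambda>n. v (s (n + 1) - s n))"

definition transcendental_type :: "('a::field \<Rightarrow> ereal) \<Rightarrow> (nat \<Rightarrow> 'a) \<Rightarrow> bool" where
  "transcendental_type v s \<longleftrightarrow>
     (\<forall>f :: 'a poly. \<exists>c. \<forall>\<^sub>F n in sequentially. v (poly f (s n)) = c)"

definition algebraic_type :: "('a::field \<Rightarrow> ereal) \<Rightarrow> (nat \<Rightarrow> 'a) \<Rightarrow> bool" where
  "algebraic_type v s \<longleftrightarrow>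
     (\<exists>f :: 'a poly. \<forall>\<^sub>F n in sequentially. v (poly f (s n)) < v (poly f (s (Suc n))))"

definition completion_pseudo_limit ::
    "('a::field \<Rightarrow> ereal) \<Rightarrow> (nat \<Rightarrow> 'a) \<Rightarrow> (nat \<Rightarrow> 'a) set \<Rightarrow> bool" where
  "completion_pseudo_limit v s \<alpha> \<longleftrightarrow>
     \<alpha> \<in> carrier (completion v) \<and>
     (\<forall>n. completion_val v (\<alpha> \<ominus>\<^bsub>completion v\<^esub> completion_embed v (s n))
        < completion_val v (\<alpha> \<ominus>\<^bsub>completion v\<^esub> completion_embed v (s (n + 1))))"


section \<open>Rings of rational functions\<close>

definition regular_at :: "'a::field poly fract \<Rightarrow> 'a \<Rightarrow> bool" where
  "regular_at \<phi> x \<longleftrightarrow> (\<exists>f g. poly g x \<noteq> 0 \<and> \<phi> = Fraction_Field.Fract f g)"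

text \<open>The value at \<open>x\<close>; unspecified at poles.\<close>

definition rat_eval :: "'a::field poly fract \<Rightarrow> 'a \<Rightarrow> 'a" where
  "rat_eval \<phi> x = (THE y. \<exists>f g. poly g x \<noteq> 0 \<and> \<phi> = Fraction_Field.Fract f g \<and>
                       y = poly f x / poly g x)"

definition polynomials :: "'a::field poly fract set" where
  "polynomials = range (\<lambda>f. Fraction_Field.Fract f 1)"

text \<open>The localization \<open>K[X]\<^sub>(\<^sub>q\<^sub>)\<close> for irreducible \<open>q\<close>.\<close>

definition poly_localization :: "'a::field poly \<Rightarrow> 'a poly fract set" where
  "poly_localization q = {Fraction_Field.Fract f g | f g. \<not> q dvd g}"

definition V_E :: "('a::field \<Rightarrow> ereal) \<Rightarrow> (nat \<Rightarrow> 'a) \<Rightarrow> 'a poly fract set" where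
  "V_E v s = {\<phi>. \<forall>\<^sub>F n in sequentially.
                  regular_at \<phi> (s n) \<and> rat_eval \<phi> (s n) \<in> valuation_ring v}"

text \<open>A rational function has finitely many poles and the terms of a pseudo-convergent sequence
  are distinct, so the limit does not depend on the unspecified values of \<open>rat_eval\<close>.\<close>

definition w_E :: "('a::field \<Rightarrow> ereal) \<Rightarrow> (nat \<Rightarrow> 'a) \<Rightarrow> 'a poly fract \<Rightarrow> ereal" where
  "w_E v s \<phi> = lim (\<lambda>n. v (rat_eval \<phi> (s n)))"

definition W_E :: "('a::field \<Rightarrow> ereal) \<Rightarrow> (nat \<Rightarrow> 'a) \<Rightarrow> 'a poly fract set" where
  "W_E v s = {\<phi>. 0 \<le> w_E v s \<phi>}"


section \<open>Residually transcendental extensions\<close>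

text \<open>In a local ring the non-units form the maximal ideal.\<close>

definition maximal_ideal :: "'a::field set \<Rightarrow> 'a set" where
  "maximal_ideal W = W - Units (ring_on W)"

definition residue_field :: "'a::field set \<Rightarrow> 'a set ring" where
  "residue_field W = ring_on W Quot maximal_ideal W"

definition const_fract :: "'a::field \<Rightarrow> 'a poly fract" where
  "const_fract c = Fraction_Field.Fract [:c:] 1"

text \<open>If the valuation domain \<open>W\<close> of \<open>K(X)\<close> lies over \<open>V\<close>, the residue field of \<open>V\<close> embeds into
  that of \<open>W\<close>; the embedded field is the image of \<open>V\<close> under \<open>V \<rightarrow> W \<rightarrow> W/M\<close>.\<close>

definition residue_subfield :: "'a::field set \<Rightarrow> 'a poly fract set \<Rightarrow> 'a poly fract set set" where
  "residue_subfield V W = (\<lambda>c. maximal_ideal W +>\<^bsub>ring_on W\<^esub> const_fract c) ` V"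

definition residually_transcendental :: "'a::field set \<Rightarrow> 'a poly fract set \<Rightarrow> bool" where
  "residually_transcendental V W \<longleftrightarrow>
     (\<exists>x \<in> carrier (residue_field W).
        ring.transcendental (residue_field W) (residue_subfield V W) x)"

end

theory Submission
  imports Defs "HOL-Library.Function_Algebras"
begin

text \<open>
  Write \<open>d\<^sub>n = v (s\<^sub>n\<^sub>+\<^sub>1 - s\<^sub>n)\<close>. Taylor expansion at \<open>s\<^sub>n\<close>, together with the fact that two
  distinct linear functions of the strictly increasing \<open>d\<^sub>n\<close> eventually do not cross, shows that
  \<open>v (\<phi> (s\<^sub>n))\<close> is eventually of the form \<open>c + k d\<^sub>n\<close> for each \<open>\<phi> \<noteq> 0\<close>, with \<open>c\<close> in the value group and
  \<open>k\<close> an integer. If \<open>E\<close> is not of transcendental type, a polynomial \<open>q\<close> of minimal degree with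
  \<open>k \<noteq> 0\<close> has \<open>k > 0\<close>, and every \<open>\<phi>\<close> is a constant times a power of \<open>q\<close>, up to a 1-unit of \<open>V\<^sub>E\<close>.

  For infinite breadth the slope \<open>k\<close> dominates: \<open>\<phi> \<mapsto> k\<close> is a discrete valuation, its ring is the
  only ring strictly between \<open>V\<^sub>E\<close> and \<open>K(X)\<close>, and it is \<open>K[X]\<^sub>(\<^sub>p\<^sub>)\<close> for the minimal
  polynomial \<open>p\<close> of the limit. For finite breadth \<open>\<delta>\<close> one has \<open>w\<^sub>E(\<phi>) = c + k \<delta>\<close>, and \<open>V\<^sub>E\<close> differs
  from \<open>W\<^sub>E\<close> exactly if \<open>c + k \<delta> = 0\<close> for some \<open>\<phi>\<close> with \<open>k > 0\<close>, i.e. if \<open>\<delta>\<close> is torsion. Such a \<open>\<phi>\<close> is a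
  unit of \<open>W\<^sub>E\<close> whose inverse is a non-unit of \<open>V\<^sub>E\<close>; hence its residue is transcendental. Without
  such \<open>\<phi>\<close> each unit of \<open>W\<^sub>E\<close> is a constant up to a 1-unit.
\<close>

section \<open>Subrings of a field and their prime ideals\<close>

lemma ring_on_simps [simp]:
  "carrier (ring_on A) = A" "x \<otimes>\<^bsub>ring_on A\<^esub> y = x * y" "\<one>\<^bsub>ring_on A\<^esub> = 1"
  "\<zero>\<^bsub>ring_on A\<^esub> = 0" "x \<oplus>\<^bsub>ring_on A\<^esub> y = x + y"
  by (simp_all add: ring_on_def)

lemma cring_ring_on_UNIV: "cring (ring_on (UNIV :: 'a::comm_ring_1 set))"
proof (rule cringI)
  show "abelian_group (ring_on (UNIV :: 'a set))"
  proof (rule abelian_groupI)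
    show "\<exists>y\<in>carrier (ring_on UNIV). y \<oplus>\<^bsub>ring_on UNIV\<^esub> x = \<zero>\<^bsub>ring_on UNIV\<^esub>" for x :: 'a
      by (intro bexI[of _ "- x"]) auto
  qed (auto simp: algebra_simps)
  show "comm_monoid (ring_on (UNIV :: 'a set))"
    by unfold_locales (auto simp: algebra_simps)
qed (auto simp: algebra_simps)

lemma a_inv_ring_on_UNIV: "\<ominus>\<^bsub>ring_on (UNIV :: 'a::comm_ring_1 set)\<^esub> x = - x"
proof -
  interpret cring "ring_on (UNIV :: 'a set)" by (rule cring_ring_on_UNIV)
  show ?thesis using minus_equality[of "- x" x] by simp
qed

lemma subring_ring_onI:
  fixes A :: "'a::comm_ring_1 set"
  assumes "1 \<in> A" "\<And>x. x \<in> A \<Longrightarrow> - x \<in> A" "\<And>x y. x \<in> A \<Longrightarrow> y \<in> A \<Longrightarrow> x * y \<in> A"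
    "\<And>x y. x \<in> A \<Longrightarrow> y \<in> A \<Longrightarrow> x + y \<in> A"
  shows "subring A (ring_on UNIV)"
proof -
  interpret cring "ring_on (UNIV :: 'a set)" by (rule cring_ring_on_UNIV)
  show ?thesis by (rule subringI) (use assms in \<open>auto simp: a_inv_ring_on_UNIV\<close>)
qed

lemma subring_ring_onD:
  fixes A :: "'a::comm_ring_1 set"
  assumes "subring A (ring_on UNIV)"
  shows "0 \<in> A" "1 \<in> A" "x \<in> A \<Longrightarrow> - x \<in> A" "x \<in> A \<Longrightarrow> y \<in> A \<Longrightarrow> x * y \<in> A"
    "x \<in> A \<Longrightarrow> y \<in> A \<Longrightarrow> x + y \<in> A" "x \<in> A \<Longrightarrow> y \<in> A \<Longrightarrow> x - y \<in> A"
    "x \<in> A \<Longrightarrow> x ^ n \<in> A"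
proof -
  show neg: "- x \<in> A" if "x \<in> A" for x
    using subringE(5)[OF assms that] by (simp add: a_inv_ring_on_UNIV)
  show "0 \<in> A" "1 \<in> A" and mult: "x \<in> A \<Longrightarrow> y \<in> A \<Longrightarrow> x * y \<in> A"
    and add: "x \<in> A \<Longrightarrow> y \<in> A \<Longrightarrow> x + y \<in> A" for x y
    using subringE[OF assms] by auto
  then show "x \<in> A \<Longrightarrow> y \<in> A \<Longrightarrow> x - y \<in> A"
    using neg[of y] add[of x "- y"] by simp
  show "x \<in> A \<Longrightarrow> x ^ n \<in> A"
    by (induction n) (auto intro: \<open>1 \<in> A\<close> mult)
qed

lemma cring_ring_on:
  fixes A :: "'a::comm_ring_1 set"
  assumes "subring A (ring_on UNIV)"
  shows "cring (ring_on A)"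
proof (rule cringI)
  show "abelian_group (ring_on A)"
  proof (rule abelian_groupI)
    show "\<exists>y\<in>carrier (ring_on A). y \<oplus>\<^bsub>ring_on A\<^esub> x = \<zero>\<^bsub>ring_on A\<^esub>" if "x \<in> carrier (ring_on A)" for x
      by (intro bexI[of _ "- x"]) (use that subring_ring_onD[OF assms] in auto)
  qed (use subring_ring_onD[OF assms] in \<open>auto simp: algebra_simps\<close>)
  show "comm_monoid (ring_on A)"
    by unfold_locales (use subring_ring_onD[OF assms] in \<open>auto simp: algebra_simps\<close>)
qed (auto simp: algebra_simps)

text \<open>Negatives need no separate clause: \<open>- 1\<close> lies in \<open>A\<close>, and
  absorbing multiples turns \<open>x\<close> into \<open>- x\<close>. The criterion keeps later
  arguments free of the record operations.\<close>

lemma ideal_ring_on_iff: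
  fixes A :: "'a::comm_ring_1 set"
  assumes A: "subring A (ring_on UNIV)"
  shows "ideal P (ring_on A) \<longleftrightarrow>
    P \<subseteq> A \<and> 0 \<in> P \<and> (\<forall>x\<in>P. \<forall>y\<in>P. x + y \<in> P) \<and> (\<forall>a\<in>A. \<forall>x\<in>P. a * x \<in> P)"
proof -
  interpret cring "ring_on A" by (rule cring_ring_on[OF A])
  show ?thesis
  proof (intro iffI conjI ballI)
    assume P: "ideal P (ring_on A)"
    interpret ideal P "ring_on A" by (fact P)
    show "P \<subseteq> A" using a_subset by simp
    show "0 \<in> P" using zero_closed by simp
    show "x + y \<in> P" if "x \<in> P" "y \<in> P" for x y
      using additive_subgroup.a_closed[OF is_additive_subgroup that] by simp
    show "a * x \<in> P" if "a \<in> A" "x \<in> P" for a x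
      using I_l_closed[of x a] that by simp
  next
    assume *: "P \<subseteq> A \<and> 0 \<in> P \<and> (\<forall>x\<in>P. \<forall>y\<in>P. x + y \<in> P) \<and> (\<forall>a\<in>A. \<forall>x\<in>P. a * x \<in> P)"
    show "ideal P (ring_on A)"
    proof (rule idealI)
      show "subgroup P (add_monoid (ring_on A))"
      proof (rule add.subgroupI)
        show "\<ominus>\<^bsub>ring_on A\<^esub> x \<in> P" if x: "x \<in> P" for x
        proof -
          have "- 1 \<in> A" using subring_ring_onD[OF A] by blast
          then have "- x \<in> P" "x \<in> A" using * x by (metis mult_minus1, blast)
          then have "\<ominus>\<^bsub>ring_on A\<^esub> x = - x" using * by (intro minus_equality) auto
          with \<open>- x \<in> P\<close> show ?thesis by simp
        qed
      qed (use * in auto)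
    next
      fix a x assume "a \<in> P" "x \<in> carrier (ring_on A)"
      with * have "x * a \<in> P" by simp
      then show "x \<otimes>\<^bsub>ring_on A\<^esub> a \<in> P" "a \<otimes>\<^bsub>ring_on A\<^esub> x \<in> P" by (simp_all add: mult.commute)
    qed (rule ring_axioms)
  qed
qed

lemma primeideal_ring_on_iff:
  fixes A :: "'a::comm_ring_1 set"
  assumes A: "subring A (ring_on UNIV)"
  shows "primeideal P (ring_on A) \<longleftrightarrow>
    P \<subseteq> A \<and> 0 \<in> P \<and> (\<forall>x\<in>P. \<forall>y\<in>P. x + y \<in> P) \<and> (\<forall>a\<in>A. \<forall>x\<in>P. a * x \<in> P) \<and> 1 \<notin> P \<and>
    (\<forall>a\<in>A. \<forall>b\<in>A. a * b \<in> P \<longrightarrow> a \<in> P \<or> b \<in> P)"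
    (is "_ = ?R")
proof
  assume P: "primeideal P (ring_on A)"
  interpret primeideal P "ring_on A" by (fact P)
  have "1 \<notin> P" using one_imp_carrier I_notcarr by auto
  moreover have "ideal P (ring_on A)" by (rule is_ideal)
  ultimately show ?R using I_prime by (auto simp: ideal_ring_on_iff[OF A])
next
  assume R: ?R
  have "P \<noteq> A" using R subring_ring_onD(2)[OF A] by blast
  then show "primeideal P (ring_on A)"
    using R cring_ring_on[OF A] by (intro primeidealI) (auto simp: ideal_ring_on_iff[OF A])
qed

lemma primeideal_powerD:
  fixes A :: "'a::comm_ring_1 set"
  assumes "subring A (ring_on UNIV)" "primeideal P (ring_on A)" "x \<in> A" "x ^ n \<in> P"
  shows "x \<in> P"
  using assms(4)
proof (induction n)
  case (Suc n)
  have "x ^ n \<in> A" using subring_ring_onD(7)[OF assms(1,3)] .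
  moreover have "\<forall>a\<in>A. \<forall>b\<in>A. a * b \<in> P \<longrightarrow> a \<in> P \<or> b \<in> P" "x * x ^ n \<in> P"
    using Suc.prems assms(2) by (simp_all add: primeideal_ring_on_iff[OF assms(1)])
  ultimately show ?case using Suc.IH assms(3) by blast
qed (use assms(2) primeideal_ring_on_iff[OF assms(1)] in simp)

section \<open>Krull dimension from explicit chains of primes\<close>

lemma krull_dim_ge:
  assumes "\<And>i. i \<le> r \<Longrightarrow> primeideal (P i) R" "\<And>i. i < r \<Longrightarrow> P i \<subset> P (Suc i)"
  shows "enat r \<le> krull_dim R"
  unfolding krull_dim_def using assms by (intro Sup_upper) blast

text \<open>A strict chain of primes is injective, hence embeds its index set into the at most
  \<open>r + 1\<close> primes available. So classifying all primes of a ring determines its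
  dimension.\<close>

lemma krull_dim_eq:
  assumes primes: "\<And>Q. primeideal Q R \<longleftrightarrow> Q \<in> P ` {..r}" and less: "\<And>i. i < r \<Longrightarrow> P i \<subset> P (Suc i)"
  shows "krull_dim R = enat r"
proof (rule antisym)
  show "enat r \<le> krull_dim R" using primes less by (intro krull_dim_ge[where P = P]) auto
  show "krull_dim R \<le> enat r"
    unfolding krull_dim_def
  proof (rule Sup_least)
    fix x assume "x \<in> {enat n | n. \<exists>P. (\<forall>i\<le>n. primeideal (P i) R) \<and> (\<forall>i<n. P i \<subset> P (Suc i))}"
    then obtain n Q where x: "x = enat n" and Q: "\<And>i. i \<le> n \<Longrightarrow> primeideal (Q i) R"
      and inc: "\<And>i. i < n \<Longrightarrow> Q i \<subset> Q (Suc i)" by blast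
    have less: "Q i \<subset> Q j" if "i < j" "j \<le> n" for i j
      using that
    proof (induction j)
      case (Suc j)
      then show ?case using inc[of j] by (cases "i = j") (auto dest: psubset_trans)
    qed simp
    have "inj_on Q {..n}"
      by (rule linorder_inj_onI) (use less in auto)
    moreover have "Q ` {..n} \<subseteq> P ` {..r}" using Q primes by auto
    ultimately have "card {..n} \<le> card {..r}"
      by (meson card_image_le card_inj_on_le card_mono finite_atMost finite_imageI le_trans)
    then show "x \<le> enat r" by (simp add: x)
  qed
qed

text \<open>Serves to exclude the full field \<open>K(X)\<close> from the overrings of dimension
  one.\<close>

lemma krull_dim_UNIV_field: "krull_dim (ring_on (UNIV :: 'a::field set)) = 0"
proof -
  have U: "subring (UNIV :: 'a set) (ring_on UNIV)" by (rule subring_ring_onI) auto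
  have "krull_dim (ring_on (UNIV :: 'a set)) = enat 0"
  proof (rule krull_dim_eq[where P = "\<lambda>_. {0}"])
    fix Q :: "'a set"
    show "primeideal Q (ring_on UNIV) \<longleftrightarrow> Q \<in> (\<lambda>_. {0}) ` {..0::nat}"
    proof
      assume "primeideal Q (ring_on UNIV)"
      then have *: "0 \<in> Q" "1 \<notin> Q" "\<And>a x. x \<in> Q \<Longrightarrow> a * x \<in> Q"
        by (auto simp: primeideal_ring_on_iff[OF U])
      have "x = 0" if "x \<in> Q" for x using *(3)[OF that, of "inverse x"] *(2) by (cases "x = 0") auto
      with * show "Q \<in> (\<lambda>_. {0}) ` {..0::nat}" by auto
    qed (auto simp: primeideal_ring_on_iff[OF U])
  qed simp
  then show ?thesis by (simp add: zero_enat_def)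
qed

lemma Units_ring_on: "Units (ring_on A) = {x \<in> A. \<exists>y\<in>A. x * y = (1::'a::comm_ring_1)}"
  by (auto simp: Units_def mult.commute)

lemma maximal_ideal_iff:
  fixes W :: "'a::field set"
  shows "x \<in> maximal_ideal W \<longleftrightarrow> x \<in> W \<and> (x = 0 \<or> inverse x \<notin> W)"
proof -
  have "(\<exists>y\<in>W. x * y = 1) \<longleftrightarrow> x \<noteq> 0 \<and> inverse x \<in> W"
    by (metis inverse_unique mult_zero_left right_inverse zero_neq_one)
  then show ?thesis by (auto simp: maximal_ideal_def Units_ring_on)
qed

section \<open>Arithmetic of a rank one valuation and the primes of its ring\<close>

context rank_one_valuation
begin

lemma v_0 [simp]: "v 0 = \<infinity>"
  by (simp add: v_eq_PInf_iff)

lemma v_real: "x \<noteq> 0 \<Longrightarrow> \<exists>r. v x = ereal r"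
  using v_not_MInf[of x] v_eq_PInf_iff[of x] by (cases "v x") auto

lemma v_1 [simp]: "v 1 = 0"
proof -
  obtain r where "v 1 = ereal r" using v_real[of 1] by auto
  then show ?thesis using v_mult[of 1 1] by (simp add: zero_ereal_def)
qed

lemma v_minus [simp]: "v (- x) = v x"
proof -
  obtain r where "v (- 1) = ereal r" using v_real[of "- 1"] by auto
  then have "v (- 1) = 0" using v_mult[of "- 1" "- 1"] by (simp add: zero_ereal_def)
  then show ?thesis using v_mult[of "- 1" x] by simp
qed

lemma v_inverse: "x \<noteq> 0 \<Longrightarrow> v (inverse x) = - v x"
  using v_mult[of x "inverse x"] v_real[of x] v_real[of "inverse x"] by (auto simp: zero_ereal_def)

lemma v_divide: "y \<noteq> 0 \<Longrightarrow> v (x / y) = v x - v y"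
  by (simp add: divide_inverse v_mult v_inverse minus_ereal_def)

lemma v_power: "v (x ^ n) = ereal (of_nat n) * v x"
proof (induction n)
  case (Suc n)
  have "ereal (real (Suc n)) * v x = v x + ereal (real n) * v x"
  proof (cases "v x")
    case (real r)
    then show ?thesis by (simp add: algebra_simps)
  next
    case PInf
    then show ?thesis by (cases "n = 0") (auto simp: zero_ereal_def[symmetric])
  next
    case MInf
    then show ?thesis using v_not_MInf by blast
  qed
  then show ?case using Suc by (simp add: v_mult)
qed (simp add: zero_ereal_def[symmetric])

lemma v_diff: "min (v x) (v y) \<le> v (x - y)"
  using v_add[of x "- y"] by simp

lemma v_diff_commute: "v (x - y) = v (y - x)"
  using v_minus[of "x - y"] by simp

text \<open>The reverse inequality comes from writing \<open>x\<close> as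
  \<open>(x + y) - y\<close>. This domination principle drives nearly all later computations of
  values.\<close>

lemma v_add_eq: "v x < v y \<Longrightarrow> v (x + y) = v x"
  using v_add[of x y] v_diff[of "x + y" y] by (auto simp: min_def split: if_splits)

text \<open>The condition \<open>c < \<infinity>\<close> covers the empty sum, whose value is
  \<infinity>.\<close>

lemma v_sum_gt: "(\<And>i. i \<in> I \<Longrightarrow> c < v (f i)) \<Longrightarrow> c < \<infinity> \<Longrightarrow> c < v (sum f I)"
proof (induction I rule: infinite_finite_induct)
  case (insert i I)
  have "c < min (v (f i)) (v (sum f I))" using insert by simp
  then show ?case using insert order_less_le_trans[OF _ v_add[of "f i" "sum f I"]] by simp
qed auto

lemma subring_valuation_ring: "subring (valuation_ring v) (ring_on UNIV)"
proof (rule subring_ring_onI)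
  show "x + y \<in> valuation_ring v" if "x \<in> valuation_ring v" "y \<in> valuation_ring v" for x y
    using that v_add[of x y] by (auto simp: valuation_ring_def min_def split: if_splits)
qed (auto simp: valuation_ring_def v_mult)

lemma maximal_ideal_valuation_ring: "maximal_ideal (valuation_ring v) = {x. 0 < v x}"
proof (rule Set.set_eqI)
  fix x show "x \<in> maximal_ideal (valuation_ring v) \<longleftrightarrow> x \<in> {x. 0 < v x}"
    using v_real[of x]
    by (cases "x = 0") (auto simp: maximal_ideal_iff valuation_ring_def v_inverse zero_ereal_def)
qed

lemma v_add_gt: "c < v x \<Longrightarrow> c < v y \<Longrightarrow> c < v (x + y)"
  using v_add[of x y] by (auto simp: min_def split: if_splits)

text \<open>If a product of two elements of nonnegative value has positive value, one factor does.
  The ring \<open>A\<close> may be smaller than the valuation ring: later it is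
  \<open>V_E v s\<close>, and \<open>v\<close> is replaced by a coarser valuation on
  \<open>K(X)\<close>, which yields a prime strictly between 0 and the maximal ideal.\<close>

lemma primeideal_positive:
  assumes "subring A (ring_on UNIV)" "A \<subseteq> valuation_ring v" "{x. 0 < v x} \<subseteq> A"
  shows "primeideal {x. 0 < v x} (ring_on A)"
proof -
  have "0 < v x \<or> 0 < v y" if "x \<in> A" "y \<in> A" "0 < v (x * y)" for x y
    using that assms(2) by (force simp: v_mult valuation_ring_def)
  then show ?thesis
    unfolding primeideal_ring_on_iff[OF assms(1)]
    using assms(2,3) by (auto simp: v_mult v_add_gt valuation_ring_def intro: add_nonneg_pos)
qed

text \<open>Elements of value 0 are units, so a prime lies inside the positive part. If it contains
  some \<open>x \<noteq> 0\<close>, the Archimedean property makes a power of any \<open>y\<close>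
  of positive value a multiple of \<open>x\<close>, and primality puts \<open>y\<close> into the
  ideal.\<close>

lemma primeideal_valuation_ring_iff:
  "primeideal P (ring_on (valuation_ring v)) \<longleftrightarrow> P = {0} \<or> P = {x. 0 < v x}"
proof
  assume P: "primeideal P (ring_on (valuation_ring v))"
  note * = P[unfolded primeideal_ring_on_iff[OF subring_valuation_ring]]
  have sub: "P \<subseteq> {x. 0 < v x}"
  proof
    fix x assume x: "x \<in> P"
    show "x \<in> {x. 0 < v x}"
    proof (rule ccontr)
      assume "x \<notin> {x. 0 < v x}"
      with x * have "v x = 0" by (auto simp: valuation_ring_def)
      then have "x \<noteq> 0" by auto
      with \<open>v x = 0\<close> have "inverse x \<in> valuation_ring v"
        by (simp add: valuation_ring_def v_inverse)
      with * x have "inverse x * x \<in> P" by blast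
      with \<open>x \<noteq> 0\<close> * show False by simp
    qed
  qed
  have "P = {x. 0 < v x}" if "P \<noteq> {0}"
  proof -
    from that * obtain x where x: "x \<in> P" "x \<noteq> 0" by blast
    then obtain a where a: "v x = ereal a" using v_real by blast
    have "y \<in> P" if y: "0 < v y" for y
    proof (cases "y = 0")
      case False
      then obtain b where b: "v y = ereal b" using v_real by blast
      with y have "0 < b" by simp
      then obtain n where "a < real n * b" using reals_Archimedean3 by blast
      with a b x have "0 \<le> v (y ^ n / x)" by (simp add: v_divide v_power)
      then have "y ^ n / x \<in> valuation_ring v" by (simp add: valuation_ring_def)
      with * x(1) have "(y ^ n / x) * x \<in> P" by blast
      with x have "y ^ n \<in> P" by simp
      then show ?thesis
        using primeideal_powerD[OF subring_valuation_ring P, of y n] y by (simp add: valuation_ring_def)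
    qed (use * in simp)
    with sub show ?thesis by blast
  qed
  then show "P = {0} \<or> P = {x. 0 < v x}" by blast
next
  have "primeideal {x. 0 < v x} (ring_on (valuation_ring v))"
    by (rule primeideal_positive[OF subring_valuation_ring]) (auto simp: valuation_ring_def)
  moreover have "primeideal {0} (ring_on (valuation_ring v))"
    unfolding primeideal_ring_on_iff[OF subring_valuation_ring] by (auto simp: valuation_ring_def)
  moreover assume "P = {0} \<or> P = {x. 0 < v x}"
  ultimately show "primeideal P (ring_on (valuation_ring v))" by blast
qed

lemma exists_pos: "\<exists>x. 0 < v x \<and> x \<noteq> 0"
proof -
  obtain x where "x \<noteq> 0" "v x \<noteq> 0" using v_nontrivial by blast
  moreover from this obtain r where "v x = ereal r" using v_real by blast
  moreover from calculation have "v (inverse x) = ereal (- r)" by (simp add: v_inverse)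
  ultimately show ?thesis
    by (cases "0 < r") (force intro: exI[of _ x] exI[of _ "inverse x"] simp: zero_ereal_def)+
qed

lemma rank_valuation_ring: "rank (valuation_ring v) = 1"
proof -
  have "krull_dim (ring_on (valuation_ring v)) = enat 1"
  proof (rule krull_dim_eq[where P = "\<lambda>i. if i = 0 then {0} else {x. 0 < v x}"])
    fix Q
    have "(\<lambda>i. if i = 0 then {0} else {x. 0 < v x}) ` {..1::nat} = {{0}, {x. 0 < v x}}"
      by (auto simp: atMost_Suc)
    then show "primeideal Q (ring_on (valuation_ring v)) \<longleftrightarrow>
        Q \<in> (\<lambda>i. if i = 0 then {0} else {x. 0 < v x}) ` {..1::nat}"
      by (simp only: primeideal_valuation_ring_iff) blast
  qed (use exists_pos in auto)
  then show ?thesis by (simp add: rank_def one_enat_def)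
qed

end

section \<open>Values along a pseudo-convergent sequence\<close>

text \<open>Cross-multiplying two representations and evaluating at \<open>x\<close> shows that the
  definite description in \<open>rat_eval\<close> has only one candidate.\<close>

lemma rat_eval_Fract:
  assumes "poly g x \<noteq> 0"
  shows "rat_eval (Fraction_Field.Fract f g) x = poly f x / poly g x"
  unfolding rat_eval_def
proof (rule the_equality)
  fix y assume "\<exists>f' g'. poly g' x \<noteq> 0 \<and> Fraction_Field.Fract f g = Fraction_Field.Fract f' g' \<and> y = poly f' x / poly g' x"
  then obtain f' g' where *: "poly g' x \<noteq> 0" "Fraction_Field.Fract f g = Fraction_Field.Fract f' g'"
    "y = poly f' x / poly g' x" by blast
  moreover from this assms have "g \<noteq> 0" "g' \<noteq> 0" by auto
  ultimately have "f * g' = f' * g" by (simp add: eq_fract)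
  then have "poly (f * g') x = poly (f' * g) x" by simp
  then have "poly f x * poly g' x = poly f' x * poly g x" by simp
  then show "y = poly f x / poly g x" by (simp add: *(3) frac_eq_eq[OF *(1) assms])
qed (use assms in blast)

text \<open>Binomial expansion of each monomial followed by an exchange of the two sums. The degree
  bound is what later allows inductive hypotheses on lower degree to be applied to the coefficients
  \<open>H i\<close> with \<open>i > 0\<close>.\<close>

lemma taylor_expansion:
  fixes f :: "'a::comm_ring_1 poly"
  obtains H where "\<And>a h. poly f (a + h) = (\<Sum>i\<le>Polynomial.degree f. poly (H i) a * h ^ i)"
    "H 0 = f" "\<And>i. 0 < i \<Longrightarrow> Polynomial.degree (H i) \<le> Polynomial.degree f - 1"
proof -
  define N where "N = Polynomial.degree f"
  \<comment> \<open>The Hasse derivatives of \<open>f\<close>: binomial coefficients replace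
    division by factorials, so the expansion is valid in every characteristic.\<close>
  define H where "H i = (\<Sum>j\<in>{i..N}. Polynomial.monom (of_nat (j choose i) * Polynomial.coeff f j) (j - i))" for i
  have "poly f (a + h) = (\<Sum>i\<le>N. poly (H i) a * h ^ i)" for a h
  proof -
    have "poly f (a + h) = (\<Sum>j\<le>N. \<Sum>i\<in>{i\<in>{..N}. i \<le> j}.
        of_nat (j choose i) * Polynomial.coeff f j * a ^ (j - i) * h ^ i)"
      unfolding poly_altdef N_def[symmetric]
    proof (rule sum.cong)
      fix j assume "j \<in> {..N}"
      then have "{i\<in>{..N}. i \<le> j} = {..j}" by auto
      then show "Polynomial.coeff f j * (a + h) ^ j = (\<Sum>i\<in>{i\<in>{..N}. i \<le> j}.
          of_nat (j choose i) * Polynomial.coeff f j * a ^ (j - i) * h ^ i)"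
        unfolding add.commute[of a h] binomial_ring by (simp add: sum_distrib_left mult_ac)
    qed simp
    also have "\<dots> = (\<Sum>i\<le>N. \<Sum>j\<in>{j\<in>{..N}. i \<le> j}.
        of_nat (j choose i) * Polynomial.coeff f j * a ^ (j - i) * h ^ i)"
      by (rule sum.swap_restrict) auto
    also have "\<dots> = (\<Sum>i\<le>N. poly (H i) a * h ^ i)"
    proof (rule sum.cong)
      fix i assume "i \<in> {..N}"
      have "{j\<in>{..N}. i \<le> j} = {i..N}" by auto
      then show "(\<Sum>j\<in>{j\<in>{..N}. i \<le> j}. of_nat (j choose i) * Polynomial.coeff f j * a ^ (j - i) * h ^ i)
          = poly (H i) a * h ^ i"
        by (simp add: H_def poly_sum poly_monom sum_distrib_right)
    qed simp
    finally show ?thesis .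
  qed
  moreover have "H 0 = f"
    by (simp add: H_def N_def poly_as_sum_of_monoms flip: atMost_atLeast0)
  moreover have "Polynomial.degree (H i) \<le> N - 1" if "0 < i" for i
    unfolding H_def using that
    by (intro degree_sum_le) (auto intro!: order_trans[OF Polynomial.degree_monom_le])
  ultimately show thesis using that N_def by blast
qed

section \<open>Gauges of a pseudo-convergent sequence and values of rational functions along
  it\<close>

locale pseudo_convergent_sequence = rank_one_valuation v for v :: "'a::field \<Rightarrow> ereal" +
  fixes s :: "nat \<Rightarrow> 'a"
  assumes pc: "pseudo_convergent v s"
begin

text \<open>Passing to a real number loses nothing: each step has a value strictly below that of the
  next step, hence a finite one.\<close>

definition d :: "nat \<Rightarrow> real" where
  "d n = real_of_ereal (v (s (Suc n) - s n))"

lemma v_step: "v (s (Suc n) - s n) = ereal (d n)"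
proof -
  have "v (s (Suc n) - s n) < v (s (Suc (Suc n)) - s (Suc n))"
    using pc by (simp add: pseudo_convergent_def)
  then have "v (s (Suc n) - s n) \<noteq> \<infinity>" by auto
  then show ?thesis
    using v_not_MInf[of "s (Suc n) - s n"] by (cases "v (s (Suc n) - s n)") (simp_all add: d_def)
qed

lemma strict_mono_d: "strict_mono d"
  unfolding strict_mono_Suc_iff
proof
  fix n
  have "v (s (Suc n) - s n) < v (s (Suc (Suc n)) - s (Suc n))"
    using pc by (simp add: pseudo_convergent_def)
  then show "d n < d (Suc n)" by (simp add: v_step)
qed

lemma d_less_iff [simp]: "d m < d n \<longleftrightarrow> m < n"
  by (rule strict_mono_less[OF strict_mono_d])

text \<open>Telescoping: in \<open>s m - s n\<close> the first step has the smallest value and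
  dominates the others.\<close>

lemma v_seq_diff: "n < m \<Longrightarrow> v (s m - s n) = ereal (d n)"
proof (induction m)
  case (Suc m)
  show ?case
  proof (cases "n = m")
    case False
    with Suc have *: "v (s m - s n) = ereal (d n)" "n < m" by auto
    have "v ((s m - s n) + (s (Suc m) - s m)) = v (s m - s n)"
      by (rule v_add_eq) (use * in \<open>simp add: v_step\<close>)
    with * show ?thesis by simp
  qed (simp add: v_step)
qed simp

text \<open>Because the terms are distinct, the finitely many zeros or poles of a rational function
  are met only finitely often; hence the eventual form of the statements below.\<close>

lemma inj_s: "inj s"
proof (rule linorder_injI)
  fix m n :: nat assume "m < n"
  then have "v (s n - s m) \<noteq> \<infinity>" by (simp add: v_seq_diff)
  then show "s m \<noteq> s n" by auto
qed

lemma eventually_poly_nonzero: "f \<noteq> 0 \<Longrightarrow> \<forall>\<^sub>F n in sequentially. poly f (s n) \<noteq> 0"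
proof -
  assume "f \<noteq> 0"
  then have "finite (s -` {x. poly f x = 0})"
    by (intro finite_vimageI poly_roots_finite inj_s) auto
  then show ?thesis
    by (simp add: cofinite_eq_sequentially[symmetric] eventually_cofinite vimage_def)
qed

text \<open>Unspecified at the poles of \<open>\<phi>\<close>, so only its behaviour for large
  \<open>n\<close> carries information in general.\<close>

definition val :: "'a poly fract \<Rightarrow> nat \<Rightarrow> ereal" where
  "val \<phi> n = v (rat_eval \<phi> (s n))"

lemma eventually_rat_eval:
  assumes "g \<noteq> 0"
  shows "\<forall>\<^sub>F n in sequentially. regular_at (Fraction_Field.Fract f g) (s n) \<and>
    rat_eval (Fraction_Field.Fract f g) (s n) = poly f (s n) / poly g (s n) \<and> poly g (s n) \<noteq> 0"
  using eventually_poly_nonzero[OF assms]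
  by eventually_elim (auto simp: rat_eval_Fract regular_at_def)

lemma val_poly: "val (Fraction_Field.Fract f 1) n = v (poly f (s n))"
  by (simp add: val_def rat_eval_Fract)

lemma val_const: "val (const_fract c) n = v c"
  by (simp add: const_fract_def val_poly)

lemma val_0: "val 0 n = \<infinity>"
  using val_poly[of 0 n] by (simp add: fract_collapse)

lemma val_1: "val 1 n = 0"
  using val_poly[of 1 n] by (simp add: fract_collapse)

lemma eventually_rat_eval_nonzero:
  assumes "\<phi> \<noteq> 0"
  shows "\<forall>\<^sub>F n in sequentially. rat_eval \<phi> (s n) \<noteq> 0"
proof -
  obtain f g where \<phi>: "\<phi> = Fraction_Field.Fract f g" "g \<noteq> 0" by (cases \<phi>)
  with assms have "f \<noteq> 0" by (auto simp: fract_collapse)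
  from eventually_poly_nonzero[OF this] eventually_rat_eval[OF \<phi>(2), of f] show ?thesis
    by eventually_elim (simp add: \<phi>)
qed

lemma eventually_val_real:
  assumes "\<phi> \<noteq> 0"
  shows "\<forall>\<^sub>F n in sequentially. \<bar>val \<phi> n\<bar> \<noteq> \<infinity>"
  using eventually_rat_eval_nonzero[OF assms]
proof eventually_elim
  case (elim n)
  then show ?case using v_real[of "rat_eval \<phi> (s n)"] by (auto simp: val_def)
qed

lemma eventually_val_mult: "\<forall>\<^sub>F n in sequentially. val (\<phi> * \<psi>) n = val \<phi> n + val \<psi> n"
proof -
  obtain f g where \<phi>: "\<phi> = Fraction_Field.Fract f g" "g \<noteq> 0" by (cases \<phi>)
  obtain f' g' where \<psi>: "\<psi> = Fraction_Field.Fract f' g'" "g' \<noteq> 0" by (cases \<psi>)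
  have "g * g' \<noteq> 0" using \<phi> \<psi> by simp
  from eventually_rat_eval[OF this, of "f * f'"] eventually_rat_eval[OF \<phi>(2), of f]
    eventually_rat_eval[OF \<psi>(2), of f']
  show ?thesis
    by eventually_elim (simp add: val_def \<phi> \<psi> flip: v_mult)
qed

lemma eventually_val_add: "\<forall>\<^sub>F n in sequentially. min (val \<phi> n) (val \<psi> n) \<le> val (\<phi> + \<psi>) n"
proof -
  obtain f g where \<phi>: "\<phi> = Fraction_Field.Fract f g" "g \<noteq> 0" by (cases \<phi>)
  obtain f' g' where \<psi>: "\<psi> = Fraction_Field.Fract f' g'" "g' \<noteq> 0" by (cases \<psi>)
  have "g * g' \<noteq> 0" using \<phi> \<psi> by simp
  from eventually_rat_eval[OF this, of "f * g' + f' * g"] eventually_rat_eval[OF \<phi>(2), of f]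
    eventually_rat_eval[OF \<psi>(2), of f']
  show ?thesis
  proof eventually_elim
    case (elim n)
    then have "rat_eval (\<phi> + \<psi>) (s n) = rat_eval \<phi> (s n) + rat_eval \<psi> (s n)"
      by (simp add: \<phi> \<psi> add_frac_eq)
    then show ?case by (simp add: val_def v_add)
  qed
qed

lemma eventually_val_minus: "\<forall>\<^sub>F n in sequentially. val (- \<phi>) n = val \<phi> n"
proof -
  have "- \<phi> = const_fract (- 1) * \<phi>"
    by (cases \<phi>) (simp add: const_fract_def)
  with eventually_val_mult[of "const_fract (- 1)" \<phi>] show ?thesis
    by (simp add: val_const)
qed

text \<open>The analogue of \<open>v_add_eq\<close>, again by writing \<open>\<phi>\<close> as
  \<open>(\<phi> + \<psi>) - \<psi>\<close>.\<close>

lemma eventually_val_add_eq: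
  assumes "\<forall>\<^sub>F n in sequentially. val \<phi> n < val \<psi> n"
  shows "\<forall>\<^sub>F n in sequentially. val (\<phi> + \<psi>) n = val \<phi> n"
  using assms eventually_val_add[of \<phi> \<psi>] eventually_val_add[of "\<phi> + \<psi>" "- \<psi>"] eventually_val_minus[of \<psi>]
  by eventually_elim (auto simp: min_def split: if_splits)

lemma eventually_val_inverse:
  assumes "\<phi> \<noteq> 0"
  shows "\<forall>\<^sub>F n in sequentially. val (inverse \<phi>) n = - val \<phi> n"
  using eventually_val_mult[of \<phi> "inverse \<phi>"] eventually_val_real[OF assms]
proof eventually_elim
  case (elim n)
  with assms have "val \<phi> n + val (inverse \<phi>) n = 0" by (simp add: val_1)
  with elim(2) show ?case
    by (cases "val \<phi> n"; cases "val (inverse \<phi>) n") (auto simp: zero_ereal_def)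
qed

lemma V_E_iff: "\<phi> \<in> V_E v s \<longleftrightarrow> (\<forall>\<^sub>F n in sequentially. 0 \<le> val \<phi> n)"
proof -
  obtain f g where \<phi>: "\<phi> = Fraction_Field.Fract f g" "g \<noteq> 0" by (cases \<phi>)
  have "\<forall>\<^sub>F n in sequentially. regular_at \<phi> (s n)"
    using eventually_rat_eval[OF \<phi>(2), of f] by eventually_elim (simp add: \<phi>)
  then show ?thesis
    by (auto simp: V_E_def val_def valuation_ring_def eventually_conj_iff)
qed

lemma subring_V_E: "subring (V_E v s) (ring_on UNIV)"
proof (rule subring_ring_onI)
  show "x + y \<in> V_E v s" if "x \<in> V_E v s" "y \<in> V_E v s" for x y
    using that[unfolded V_E_iff] eventually_val_add[of x y]
    unfolding V_E_iff by eventually_elim (auto simp: min_def split: if_splits)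
  show "x * y \<in> V_E v s" if "x \<in> V_E v s" "y \<in> V_E v s" for x y
    using that[unfolded V_E_iff] eventually_val_mult[of x y]
    unfolding V_E_iff by eventually_elim auto
  show "- x \<in> V_E v s" if "x \<in> V_E v s" for x
    using that[unfolded V_E_iff] eventually_val_minus[of x]
    unfolding V_E_iff by eventually_elim auto
qed (simp add: V_E_iff val_1)

text \<open>Once all values are eventually linear, an element of \<open>V_E v s\<close> outside this
  set has eventual value 0 and is a unit; the set is then the maximal ideal of
  \<open>V_E v s\<close>.\<close>

definition m_E :: "'a poly fract set" where
  "m_E = {\<phi>. \<forall>\<^sub>F n in sequentially. 0 < val \<phi> n}"

lemma m_E_subset: "m_E \<subseteq> V_E v s"
  by (auto simp: m_E_def V_E_iff elim!: eventually_mono)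

lemma zero_in_m_E: "0 \<in> m_E"
  by (simp add: m_E_def val_0)

lemma m_E_add:
  assumes "x \<in> m_E" "y \<in> m_E"
  shows "x + y \<in> m_E"
  using assms eventually_val_add[of x y] unfolding m_E_def mem_Collect_eq
  by eventually_elim (auto simp: min_def split: if_splits)

lemma m_E_minus:
  assumes "x \<in> m_E"
  shows "- x \<in> m_E"
  using assms eventually_val_minus[of x] unfolding m_E_def mem_Collect_eq
  by eventually_elim auto

lemma m_E_mult:
  assumes "x \<in> V_E v s" "y \<in> m_E"
  shows "x * y \<in> m_E"
  using assms eventually_val_mult[of x y] unfolding m_E_def mem_Collect_eq V_E_iff
  by eventually_elim (auto intro: add_nonneg_pos)

lemma one_notin_m_E: "1 \<notin> m_E"
  by (simp add: m_E_def val_1)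

text \<open>Scaling by \<open>e\<close> allows a limit to exist even if the breadth is infinite.\<close>

lemma rank_one_valuation_limit:
  assumes e: "\<forall>\<^sub>F n in sequentially. 0 < e n"
    and w: "\<And>\<phi>. (\<lambda>n. val \<phi> n * ereal (e n)) \<longlonglongrightarrow> w \<phi>"
    and fin: "\<And>\<phi>. \<phi> \<noteq> 0 \<Longrightarrow> \<bar>w \<phi>\<bar> \<noteq> \<infinity>"
    and nontriv: "\<phi>\<^sub>0 \<noteq> 0" "w \<phi>\<^sub>0 \<noteq> 0"
  shows "rank_one_valuation w"
proof
  have "(\<lambda>n. val 0 n * ereal (e n)) \<longlonglongrightarrow> \<infinity>"
    by (rule tendsto_eventually, use e in eventually_elim) (simp add: val_0)
  then have w_0: "w 0 = \<infinity>" using w LIMSEQ_unique by blast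
  show w_MInf: "w \<phi> \<noteq> - \<infinity>" for \<phi> using fin[of \<phi>] w_0 by (cases "\<phi> = 0") auto
  show "w \<phi> = \<infinity> \<longleftrightarrow> \<phi> = 0" for \<phi> using fin[of \<phi>] w_0 by (cases "\<phi> = 0") auto
  show "w (\<phi> * \<psi>) = w \<phi> + w \<psi>" for \<phi> \<psi>
  proof (cases "\<phi> = 0 \<or> \<psi> = 0")
    case True
    then show ?thesis using w_0 w_MInf by auto
  next
    case False
    then have \<phi>: "\<phi> \<noteq> 0" and \<psi>: "\<psi> \<noteq> 0" by auto
    have "(\<lambda>n. val \<phi> n * ereal (e n) + val \<psi> n * ereal (e n)) \<longlonglongrightarrow> w \<phi> + w \<psi>"
      by (rule tendsto_add_ereal[OF _ _ w w]) (use fin False in auto)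
    moreover have "\<forall>\<^sub>F n in sequentially.
        val \<phi> n * ereal (e n) + val \<psi> n * ereal (e n) = val (\<phi> * \<psi>) n * ereal (e n)"
      using eventually_val_mult[of \<phi> \<psi>] eventually_val_real[OF \<phi>] eventually_val_real[OF \<psi>]
    proof eventually_elim
      case (elim n)
      then obtain a b where "val \<phi> n = ereal a" "val \<psi> n = ereal b" by (cases "val \<phi> n"; cases "val \<psi> n") auto
      with elim(1) show ?case by (simp add: algebra_simps)
    qed
    ultimately have "(\<lambda>n. val (\<phi> * \<psi>) n * ereal (e n)) \<longlonglongrightarrow> w \<phi> + w \<psi>"
      by (rule Lim_transform_eventually)
    then show ?thesis using w LIMSEQ_unique by blast
  qed
  show "min (w \<phi>) (w \<psi>) \<le> w (\<phi> + \<psi>)" for \<phi> \<psi>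
  proof (rule tendsto_le[OF _ w tendsto_min[OF w w]])
    show "\<forall>\<^sub>F n in sequentially.
        min (val \<phi> n * ereal (e n)) (val \<psi> n * ereal (e n)) \<le> val (\<phi> + \<psi>) n * ereal (e n)"
      using eventually_val_add[of \<phi> \<psi>] e
    proof eventually_elim
      case (elim n)
      then have "val \<phi> n \<le> val (\<phi> + \<psi>) n \<or> val \<psi> n \<le> val (\<phi> + \<psi>) n"
        by (auto simp: min_def split: if_splits)
      then show ?case using elim(2) by (auto simp: min_le_iff_disj intro: ereal_mult_right_mono)
    qed
  qed simp
  show "\<exists>\<phi>. \<phi> \<noteq> 0 \<and> w \<phi> \<noteq> 0" using nontriv by blast
qed

text \<open>For positive slope the values strictly increase with \<open>d\<close>, so once
  nonnegative they are positive from the next index on; otherwise they stay negative. Negative slope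
  follows by negation. Only monotonicity of \<open>d\<close> enters, so finite and infinite breadth
  are treated alike.\<close>

lemma line_sign:
  fixes c k :: real
  assumes "c \<noteq> 0 \<or> k \<noteq> 0"
  shows "(\<forall>\<^sub>F n in sequentially. 0 < c + k * d n) \<or> (\<forall>\<^sub>F n in sequentially. c + k * d n < 0)"
proof -
  have *: "(\<forall>\<^sub>F n in sequentially. 0 < c + k * d n) \<or> (\<forall>\<^sub>F n in sequentially. c + k * d n < 0)"
    if "0 < k" for c k :: real
  proof (cases "\<exists>N. 0 \<le> c + k * d N")
    case True
    then obtain N where N: "0 \<le> c + k * d N" by blast
    have "0 < c + k * d n" if "N < n" for n
    proof -
      have "k * d N < k * d n" using \<open>0 < k\<close> that by simp
      with N show ?thesis by simp
    qed
    then have "\<forall>\<^sub>F n in sequentially. 0 < c + k * d n"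
      using eventually_gt_at_top[of N] by (rule eventually_mono[rotated])
    then show ?thesis ..
  next
    case False
    then have "\<forall>\<^sub>F n in sequentially. c + k * d n < 0" by (auto simp: not_le)
    then show ?thesis ..
  qed
  consider "k = 0" "c < 0" | "k = 0" "0 < c" | "0 < k" | "0 < - k" using assms by linarith
  then show ?thesis
  proof cases
    case 4
    from *[OF this, of "- c"] show ?thesis
    proof
      assume "\<forall>\<^sub>F n in sequentially. 0 < - c + - k * d n"
      then have "\<forall>\<^sub>F n in sequentially. c + k * d n < 0" by eventually_elim simp
      then show ?thesis ..
    next
      assume "\<forall>\<^sub>F n in sequentially. - c + - k * d n < 0"
      then have "\<forall>\<^sub>F n in sequentially. 0 < c + k * d n" by eventually_elim simp
      then show ?thesis ..
    qed
  qed (use * in auto)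
qed

text \<open>The pair \<open>(c, k)\<close> is additive in \<open>\<phi>\<close> and determined by it
  (\<open>asym_mult\<close>, \<open>asym_unique\<close>). The valuations on \<open>K(X)\<close> used
  later are read off from it: \<open>k\<close> for infinite breadth, \<open>c + k \<delta>\<close>
  for finite breadth, \<open>c\<close> for transcendental type.\<close>

definition asym :: "'a poly fract \<Rightarrow> real \<Rightarrow> int \<Rightarrow> bool" where
  "asym \<phi> c k \<longleftrightarrow> (\<forall>\<^sub>F n in sequentially. val \<phi> n = ereal (c + of_int k * d n))"

lemma asym_mult:
  assumes "asym \<phi> c k" "asym \<psi> c' k'"
  shows "asym (\<phi> * \<psi>) (c + c') (k + k')"
  using assms eventually_val_mult[of \<phi> \<psi>] unfolding asym_def
  by eventually_elim (auto simp: algebra_simps)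

lemma asym_nonzero: "asym \<phi> c k \<Longrightarrow> \<phi> \<noteq> 0"
  unfolding asym_def using eventually_happens'[OF sequentially_bot] by (fastforce simp: val_0)

lemma asym_inverse:
  assumes "asym \<phi> c k"
  shows "asym (inverse \<phi>) (- c) (- k)"
  using assms eventually_val_inverse[OF asym_nonzero[OF assms]] unfolding asym_def
  by eventually_elim simp

lemma asym_divide: "asym \<phi> c k \<Longrightarrow> asym \<psi> c' k' \<Longrightarrow> asym (\<phi> / \<psi>) (c - c') (k - k')"
  using asym_mult[OF _ asym_inverse, of \<phi> c k \<psi> c' k'] by (simp add: divide_inverse)

lemma asym_power: "asym \<phi> c k \<Longrightarrow> asym (\<phi> ^ n) (of_nat n * c) (of_nat n * k)"
proof (induction n)
  case 0
  show ?case by (simp add: asym_def val_1 zero_ereal_def)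
next
  case (Suc n)
  then have "asym (\<phi> ^ Suc n) (c + of_nat n * c) (k + of_nat n * k)"
    unfolding power_Suc by (intro asym_mult)
  then show ?case by (simp add: algebra_simps)
qed

lemma asym_const: "v x = ereal c \<Longrightarrow> asym (const_fract x) c 0"
  by (simp add: asym_def val_const)

text \<open>The difference of the two lines vanishes eventually, whereas by \<open>line_sign\<close>
  a nonzero line has eventually a strict sign.\<close>

lemma asym_unique:
  assumes "asym \<phi> c k" "asym \<phi> c' k'"
  shows "c = c'" "k = k'"
proof -
  have "\<forall>\<^sub>F n in sequentially. (c - c') + (of_int k - of_int k') * d n = 0"
    using assms unfolding asym_def by eventually_elim (simp add: algebra_simps)
  moreover have False if "c - c' \<noteq> 0 \<or> real_of_int k - of_int k' \<noteq> 0"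
    using line_sign[OF that]
  proof
    assume "\<forall>\<^sub>F n in sequentially. 0 < (c - c') + (real_of_int k - of_int k') * d n"
    with calculation have "\<forall>\<^sub>F n in sequentially. False" by eventually_elim simp
    then show False by simp
  next
    assume "\<forall>\<^sub>F n in sequentially. (c - c') + (real_of_int k - of_int k') * d n < 0"
    with calculation have "\<forall>\<^sub>F n in sequentially. False" by eventually_elim simp
    then show False by simp
  qed
  ultimately show "c = c'" "k = k'" by auto
qed

lemma asym_cases:
  assumes "asym \<phi> c k"
  obtains "\<forall>\<^sub>F n in sequentially. 0 < val \<phi> n" | "\<forall>\<^sub>F n in sequentially. val \<phi> n < 0" |
    "c = 0" "k = 0" "\<forall>\<^sub>F n in sequentially. val \<phi> n = 0"
proof (cases "c = 0 \<and> k = 0")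
  case True
  with assms that(3) show thesis by (auto simp: asym_def zero_ereal_def)
next
  case False
  then have "(\<forall>\<^sub>F n in sequentially. 0 < c + of_int k * d n) \<or> (\<forall>\<^sub>F n in sequentially. c + of_int k * d n < 0)"
    by (intro line_sign) auto
  then show thesis
  proof
    assume "\<forall>\<^sub>F n in sequentially. 0 < c + of_int k * d n"
    with assms[unfolded asym_def] have "\<forall>\<^sub>F n in sequentially. 0 < val \<phi> n"
      by eventually_elim simp
    then show thesis by (rule that(1))
  next
    assume "\<forall>\<^sub>F n in sequentially. c + of_int k * d n < 0"
    with assms[unfolded asym_def] have "\<forall>\<^sub>F n in sequentially. val \<phi> n < 0"
      by eventually_elim simp
    then show thesis by (rule that(2))
  qed
qed

end

section \<open>Eventual linearity of the values\<close>

context rank_one_valuation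
begin

lemma v_power_real: "v x = ereal a \<Longrightarrow> v (x ^ n) = ereal (of_nat n * a)"
  by (simp add: v_power)

lemma v_power_int_real:
  assumes "v x = ereal a"
  shows "v (x powi k) = ereal (of_int k * a)"
proof (cases "0 \<le> k")
  case True
  then show ?thesis using v_power_real[OF assms, of "nat k"] by (simp add: power_int_def)
next
  case False
  have "x \<noteq> 0" using assms by auto
  then have "v (inverse x) = ereal (- a)" using assms by (simp add: v_inverse)
  with False show ?thesis
    using v_power_real[of "inverse x" "- a" "nat (- k)"] by (simp add: power_int_def)
qed

end

context pseudo_convergent_sequence
begin

text \<open>By induction a new line needs to be compared only with the line that has been least so
  far.\<close>

lemma eventually_least_line:
  fixes c :: "nat \<Rightarrow> real"
  assumes "finite I" "I \<noteq> {}"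
  shows "\<exists>k\<in>I. \<forall>\<^sub>F n in sequentially. \<forall>i\<in>I - {k}. c k + of_nat k * d n < c i + of_nat i * d n"
  using assms
proof (induction I rule: finite_ne_induct)
  case (insert x I)
  then obtain k where k: "k \<in> I"
    and less: "\<forall>\<^sub>F n in sequentially. \<forall>i\<in>I - {k}. c k + of_nat k * d n < c i + of_nat i * d n" by blast
  \<comment> \<open>The index of a line is its slope, so distinct indices never give the same
    line.\<close>
  from insert k have "c k - c x \<noteq> 0 \<or> real k - real x \<noteq> 0" by auto
  from line_sign[OF this] show ?case
  proof
    assume "\<forall>\<^sub>F n in sequentially. 0 < c k - c x + (real k - real x) * d n"
    with less have "\<forall>\<^sub>F n in sequentially. \<forall>i\<in>insert x I - {x}. c x + of_nat x * d n < c i + of_nat i * d n"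
    proof eventually_elim
      case (elim n)
      then have "c x + of_nat x * d n < c k + of_nat k * d n" by (simp add: algebra_simps)
      then show ?case using elim(1) by (smt (verit) Diff_iff insert_iff)
    qed
    then show ?thesis by blast
  next
    assume "\<forall>\<^sub>F n in sequentially. c k - c x + (real k - real x) * d n < 0"
    with less have "\<forall>\<^sub>F n in sequentially. \<forall>i\<in>insert x I - {k}. c k + of_nat k * d n < c i + of_nat i * d n"
    proof eventually_elim
      case (elim n)
      then have "c k + of_nat k * d n < c x + of_nat x * d n" by (simp add: algebra_simps)
      then show ?case using elim(1) by auto
    qed
    with k show ?thesis by blast
  qed
qed auto

text \<open>The constant is required to be real, so the zero polynomial is not stable and has to be
  set apart where all polynomials are considered.\<close>

definition stable :: "'a poly \<Rightarrow> bool" where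
  "stable f \<longleftrightarrow> (\<exists>c::real. \<forall>\<^sub>F n in sequentially. v (poly f (s n)) = ereal c)"

text \<open>The terms of the sequence make the field infinite, so \<open>f - f(0)\<close>, being a
  nonzero polynomial, does not vanish identically as a function.\<close>

lemma nonconstant_values:
  fixes f :: "'a poly"
  assumes "0 < Polynomial.degree f"
  obtains a b where "poly f a \<noteq> poly f b"
proof -
  define g where "g = f - [:poly f 0:]"
  have "g \<noteq> 0"
  proof
    assume "g = 0"
    then have "f = [:poly f 0:]" by (simp add: g_def)
    then have "Polynomial.degree f = 0" by (metis degree_pCons_0)
    with assms show False by simp
  qed
  then obtain n where "poly g (s n) \<noteq> 0"
    using eventually_happens'[OF sequentially_bot eventually_poly_nonzero] by blast
  then show thesis using that[of "s n" 0] by (simp add: g_def)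
qed

text \<open>In the Taylor expansion at \<open>s n\<close> the constant term cancels, and the
  remaining coefficients have smaller degree and hence stable values. The summands then lie on lines
  with distinct slopes \<open>i \<ge> 1\<close>; the eventually least one dominates and gives the
  value of the difference.\<close>

lemma difference_values:
  assumes deg: "0 < Polynomial.degree f"
    and stable: "\<And>g. g \<noteq> 0 \<Longrightarrow> Polynomial.degree g < Polynomial.degree f \<Longrightarrow> stable g"
  obtains c :: real and k :: nat where "1 \<le> k"
    "\<forall>\<^sub>F n in sequentially. \<forall>m>n. v (poly f (s m) - poly f (s n)) = ereal (c + of_nat k * d n)"
proof -
  define N where "N = Polynomial.degree f"
  obtain H where H: "\<And>a h. poly f (a + h) = (\<Sum>i\<le>N. poly (H i) a * h ^ i)"
    "H 0 = f" "\<And>i. 0 < i \<Longrightarrow> Polynomial.degree (H i) \<le> N - 1"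
    using taylor_expansion[of f] unfolding N_def by metis
  define I where "I = {i\<in>{1..N}. H i \<noteq> 0}"
  have I: "finite I" by (simp add: I_def)
  have diff: "poly f b - poly f a = (\<Sum>i\<in>I. poly (H i) a * (b - a) ^ i)" for a b
  proof -
    have "poly f b = (\<Sum>i\<in>insert 0 {1..N}. poly (H i) a * (b - a) ^ i)"
      using H(1)[of a "b - a"] by (simp add: atMost_atLeast0 flip: atLeastAtMost_insertL[of 0 N])
    also have "\<dots> = poly f a + (\<Sum>i\<in>{1..N}. poly (H i) a * (b - a) ^ i)"
      by (simp add: H(2))
    also have "(\<Sum>i\<in>{1..N}. poly (H i) a * (b - a) ^ i) = (\<Sum>i\<in>I. poly (H i) a * (b - a) ^ i)"
      by (rule sum.mono_neutral_right) (auto simp: I_def)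
    finally show ?thesis by simp
  qed
  have "I \<noteq> {}"
  proof
    assume "I = {}"
    with diff have "poly f b = poly f a" for a b by simp
    with nonconstant_values[OF deg] show False by metis
  qed
  have "\<forall>i\<in>I. \<exists>c::real. \<forall>\<^sub>F n in sequentially. v (poly (H i) (s n)) = ereal c"
  proof
    fix i assume "i \<in> I"
    then have "H i \<noteq> 0" "Polynomial.degree (H i) < Polynomial.degree f"
      using H(3)[of i] deg by (auto simp: I_def N_def)
    with stable show "\<exists>c::real. \<forall>\<^sub>F n in sequentially. v (poly (H i) (s n)) = ereal c"
      unfolding stable_def by blast
  qed
  then obtain c :: "nat \<Rightarrow> real" where
    c: "\<And>i. i \<in> I \<Longrightarrow> \<forall>\<^sub>F n in sequentially. v (poly (H i) (s n)) = ereal (c i)"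
    by metis
  obtain k where k: "k \<in> I"
    and least: "\<forall>\<^sub>F n in sequentially. \<forall>i\<in>I - {k}. c k + of_nat k * d n < c i + of_nat i * d n"
    using eventually_least_line[OF I \<open>I \<noteq> {}\<close>] by blast
  have "\<forall>\<^sub>F n in sequentially. \<forall>i\<in>I. v (poly (H i) (s n)) = ereal (c i)"
    using c by (intro eventually_ball_finite I) auto
  with least have "\<forall>\<^sub>F n in sequentially. \<forall>m>n. v (poly f (s m) - poly f (s n)) = ereal (c k + of_nat k * d n)"
  proof eventually_elim
    case (elim n)
    show ?case
    proof (intro allI impI)
      fix m assume "n < m"
      have t: "v (poly (H i) (s n) * (s m - s n) ^ i) = ereal (c i + of_nat i * d n)" if "i \<in> I" for i
        using elim(2) that by (simp add: v_mult v_power_real[OF v_seq_diff[OF \<open>n < m\<close>]])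
      have "v (poly f (s m) - poly f (s n)) = v (poly (H k) (s n) * (s m - s n) ^ k
          + (\<Sum>i\<in>I - {k}. poly (H i) (s n) * (s m - s n) ^ i))"
        unfolding diff using k I by (simp add: sum.remove)
      also have "\<dots> = v (poly (H k) (s n) * (s m - s n) ^ k)"
        by (rule v_add_eq, rule v_sum_gt) (use t k elim(1) in auto)
      finally show "v (poly f (s m) - poly f (s n)) = ereal (c k + of_nat k * d n)"
        using t[OF k] by simp
    qed
  qed
  moreover have "1 \<le> k" using k by (simp add: I_def)
  ultimately show thesis using that by blast
qed

text \<open>Compare \<open>v (f (s n))\<close> with the line at a single large \<open>n\<close>. If
  it is below, it dominates and all later values equal it; if it is above, the difference dominates
  and all later values equal \<open>c + k * d n\<close>. Both make \<open>f\<close> stable, so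
  otherwise the value is on the line for every large \<open>n\<close>.\<close>

lemma stable_or_line:
  fixes c k :: real
  assumes k: "0 < k"
    and ev: "\<forall>\<^sub>F n in sequentially. \<forall>m>n. v (poly f (s m) - poly f (s n)) = ereal (c + k * d n)"
  shows "stable f \<or> (\<forall>\<^sub>F n in sequentially. v (poly f (s n)) = ereal (c + k * d n))"
proof -
  obtain N where N: "\<And>n m. N \<le> n \<Longrightarrow> n < m \<Longrightarrow> v (poly f (s m) - poly f (s n)) = ereal (c + k * d n)"
    using ev unfolding eventually_sequentially by blast
  have stable: "stable f" if "\<And>m. n < m \<Longrightarrow> v (poly f (s m)) = ereal a" for n a
    unfolding stable_def eventually_sequentially using that by (intro exI[of _ a] exI[of _ "Suc n"]) auto
  have "stable f" if n: "N \<le> n" "v (poly f (s n)) < ereal (c + k * d n)" for n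
  proof -
    from n have "v (poly f (s n)) \<noteq> \<infinity>" by auto
    then obtain a where a: "v (poly f (s n)) = ereal a" using v_real v_0 by metis
    show ?thesis
    proof (rule stable)
      fix m assume "n < m"
      then have "v (poly f (s n) + (poly f (s m) - poly f (s n))) = v (poly f (s n))"
        by (intro v_add_eq) (use n N in simp)
      with a show "v (poly f (s m)) = ereal a" by simp
    qed
  qed
  moreover have "stable f" if n: "N \<le> n" "ereal (c + k * d n) < v (poly f (s n))" for n
  proof (rule stable)
    fix m assume "n < m"
    then have "v ((poly f (s m) - poly f (s n)) + poly f (s n)) = v (poly f (s m) - poly f (s n))"
      by (intro v_add_eq) (use n N in simp)
    with N[OF n(1) \<open>n < m\<close>] show "v (poly f (s m)) = ereal (c + k * d n)" by simp
  qed
  ultimately show ?thesis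
    unfolding eventually_sequentially by (metis linorder_less_linear)
qed

section \<open>The group of 1-units of \<open>V_E v s\<close>\<close>

definition U1 :: "'a poly fract set" where
  "U1 = {u. u - 1 \<in> m_E}"

lemma U1_val: "u \<in> U1 \<Longrightarrow> \<forall>\<^sub>F n in sequentially. val u n = 0"
  using eventually_val_add_eq[of 1 "u - 1"] by (simp add: U1_def m_E_def val_1)

lemma U1_V_E: "u \<in> U1 \<Longrightarrow> u \<in> V_E v s"
  using U1_val[of u] by (auto simp: V_E_iff elim!: eventually_mono)

lemma U1_asym: "u \<in> U1 \<Longrightarrow> asym u 0 0"
  using U1_val by (simp add: asym_def zero_ereal_def)

lemma U1_mult:
  assumes "u \<in> U1" "u' \<in> U1"
  shows "u * u' \<in> U1"
proof -
  have "u * (u' - 1) + (u - 1) \<in> m_E"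
    using assms U1_V_E by (intro m_E_add m_E_mult) (auto simp: U1_def)
  then show ?thesis by (simp add: U1_def algebra_simps)
qed

lemma U1_inverse:
  assumes "u \<in> U1"
  shows "inverse u \<in> U1"
proof -
  have u: "asym u 0 0" using assms by (rule U1_asym)
  then have "asym (inverse u) 0 0" using asym_inverse by fastforce
  then have "inverse u \<in> V_E v s" unfolding V_E_iff asym_def by eventually_elim simp
  then have "- inverse u \<in> V_E v s" using subring_ring_onD(3)[OF subring_V_E] by blast
  then have "- inverse u * (u - 1) \<in> m_E" using assms by (intro m_E_mult) (auto simp: U1_def)
  moreover have "- inverse u * (u - 1) = inverse u - 1"
    using asym_nonzero[OF u] by (simp add: algebra_simps)
  ultimately show ?thesis by (simp add: U1_def)
qed

lemma asym_dichotomy: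
  assumes "asym \<phi> c k" "c \<noteq> 0 \<or> k \<noteq> 0"
  shows "\<phi> \<in> m_E \<or> inverse \<phi> \<in> m_E"
  using assms(1)
proof (cases rule: asym_cases)
  case 2
  with eventually_val_inverse[OF asym_nonzero[OF assms(1)]]
  have "\<forall>\<^sub>F n in sequentially. 0 < val (inverse \<phi>) n" by eventually_elim simp
  then show ?thesis by (simp add: m_E_def)
qed (use assms(2) in \<open>auto simp: m_E_def\<close>)

lemma asym_power_int:
  assumes "asym \<phi> c k"
  shows "asym (\<phi> powi i) (of_int i * c) (i * k)"
proof (cases "0 \<le> i")
  case True
  then show ?thesis using asym_power[OF assms, of "nat i"] by (simp add: power_int_def)
next
  case False
  then show ?thesis using asym_power[OF asym_inverse[OF assms], of "nat (- i)"] by (simp add: power_int_def)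
qed

text \<open>Evaluate \<open>\<phi>\<close> at one suitable index \<open>n\<close> and divide by the
  \<open>k\<close>-th power of \<open>s (Suc n) - s n\<close>, whose value is \<open>d n\<close>; an
  element of \<open>K\<close> of value \<open>c\<close> remains.\<close>

lemma asym_value_group:
  assumes "asym \<phi> c k"
  shows "c \<in> value_group v"
proof -
  obtain n where n: "val \<phi> n = ereal (c + of_int k * d n)"
    using assms eventually_happens'[OF sequentially_bot] unfolding asym_def by blast
  define x where "x = rat_eval \<phi> (s n) * (s (Suc n) - s n) powi (- k)"
  have "v x = ereal c"
    using n v_power_int_real[OF v_step[of n], of "- k"] by (simp add: x_def v_mult val_def)
  moreover from this have "x \<noteq> 0" by auto
  ultimately show ?thesis unfolding value_group_def by blast
qed

abbreviation of_poly :: "'a poly \<Rightarrow> 'a poly fract" where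
  "of_poly f \<equiv> Fraction_Field.Fract f 1"

lemma const_mult: "const_fract (x * y) = const_fract x * const_fract y"
  and const_inverse: "x \<noteq> 0 \<Longrightarrow> const_fract (inverse x) = inverse (const_fract x)"
  and const_1: "const_fract 1 = 1" and const_0: "const_fract 0 = 0"
  and const_eq_0_iff: "const_fract x = 0 \<longleftrightarrow> x = 0"
  and const_add: "const_fract (x + y) = const_fract x + const_fract y"
  and const_minus: "const_fract (- x) = - const_fract x"
  by (auto simp: const_fract_def Zero_fract_def One_fract_def eq_fract pCons_one)

text \<open>For polynomials the slope is 0 by hypothesis, and the constant is real because a nonzero
  polynomial vanishes at only finitely many terms. Quotients inherit both.\<close>

lemma transcendental_asym:
  assumes "transcendental_type v s" "\<phi> \<noteq> 0"
  shows "\<exists>c. asym \<phi> c 0"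
proof -
  have *: "\<exists>c. asym (of_poly f) c 0" if "f \<noteq> 0" for f
  proof -
    from assms(1) obtain c where c: "\<forall>\<^sub>F n in sequentially. v (poly f (s n)) = c"
      unfolding transcendental_type_def by blast
    with eventually_poly_nonzero[OF that] have "\<forall>\<^sub>F n in sequentially. \<exists>r. c = ereal r"
      by eventually_elim (use v_real in blast)
    then obtain r where "c = ereal r" by auto
    with c show ?thesis by (auto simp: asym_def val_poly)
  qed
  obtain f g where \<phi>: "\<phi> = Fraction_Field.Fract f g" "g \<noteq> 0" by (cases \<phi>)
  with assms have "f \<noteq> 0" by (auto simp: fract_collapse)
  from *[OF this] *[OF \<phi>(2)] asym_divide[of "of_poly f" _ 0 "of_poly g" _ 0] show ?thesis
    by (auto simp: \<phi>)
qed

end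

section \<open>A polynomial of least degree without stable values, and the decomposition of rational
  functions\<close>

locale key_polynomial = pseudo_convergent_sequence v s for v :: "'a::field \<Rightarrow> ereal" and s +
  fixes q :: "'a poly"
  assumes not_stable_q: "\<not> stable q" and q_nonzero: "q \<noteq> 0"
    and stable_less: "g \<noteq> 0 \<Longrightarrow> Polynomial.degree g < Polynomial.degree q \<Longrightarrow> stable g"
begin

lemma degree_q: "0 < Polynomial.degree q"
proof (rule ccontr)
  assume "\<not> 0 < Polynomial.degree q"
  then obtain c where "q = [:c:]" by (auto elim: degree_eq_zeroE)
  with not_stable_q q_nonzero v_real[of c] show False by (auto simp: stable_def)
qed

text \<open>Minimality of the degree makes \<open>difference_values\<close> applicable, and of the
  two alternatives of \<open>stable_or_line\<close> only the line is left.\<close>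

lemma asym_q: "\<exists>c k. 1 \<le> k \<and> asym (of_poly q) c k"
proof -
  obtain c :: real and k :: nat where k: "1 \<le> k"
    and "\<forall>\<^sub>F n in sequentially. \<forall>m>n. v (poly q (s m) - poly q (s n)) = ereal (c + of_nat k * d n)"
    using difference_values[OF degree_q stable_less] by blast
  with stable_or_line[of "of_nat k" q c] not_stable_q
  have "\<forall>\<^sub>F n in sequentially. v (poly q (s n)) = ereal (c + of_nat k * d n)" by simp
  with k show ?thesis by (intro exI[of _ c] exI[of _ "int k"]) (simp add: asym_def val_poly)
qed

text \<open>The constant \<open>x\<close> is the value of \<open>a\<close> at a sufficiently late
  term. Later values of \<open>a\<close> differ from \<open>x\<close> by something of larger value
  than \<open>x\<close>, so \<open>a / x\<close> is a 1-unit.\<close>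

lemma residue_of_small_degree:
  assumes "a \<noteq> 0" "Polynomial.degree a < Polynomial.degree q"
  shows "\<exists>x u. x \<noteq> 0 \<and> u \<in> U1 \<and> of_poly a = const_fract x * u"
proof -
  have "\<exists>x. x \<noteq> 0 \<and> (\<forall>\<^sub>F m in sequentially. v x < v (poly a (s m) - x))"
  proof (cases "Polynomial.degree a = 0")
    case True
    then obtain c where "a = [:c:]" by (auto elim: degree_eq_zeroE)
    with assms v_real[of c] show ?thesis by (intro exI[of _ c]) auto
  next
    case False
    then have "0 < Polynomial.degree a" by simp
    moreover have "stable g" if "g \<noteq> 0" "Polynomial.degree g < Polynomial.degree a" for g
      using that assms(2) by (intro stable_less) auto
    ultimately obtain c :: real and k :: nat where k: "1 \<le> k" and
      "\<forall>\<^sub>F n in sequentially. \<forall>m>n. v (poly a (s m) - poly a (s n)) = ereal (c + of_nat k * d n)"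
      by (rule difference_values[of a])
    moreover obtain e :: real where "\<forall>\<^sub>F n in sequentially. v (poly a (s n)) = ereal e"
      using stable_less assms unfolding stable_def by blast
    ultimately have "\<forall>\<^sub>F n in sequentially. (\<forall>m>n. v (poly a (s m) - poly a (s n)) =
        ereal (c + of_nat k * d n)) \<and> v (poly a (s n)) = ereal e" by (simp add: eventually_conj_iff)
    then obtain N where
      diff: "\<And>m n. N \<le> n \<Longrightarrow> n < m \<Longrightarrow> v (poly a (s m) - poly a (s n)) = ereal (c + of_nat k * d n)"
      and e: "\<And>n. N \<le> n \<Longrightarrow> v (poly a (s n)) = ereal e"
      unfolding eventually_sequentially by blast
    \<comment> \<open>The difference of two elements of value \<open>e\<close> has value at least
      \<open>e\<close>. This gives only a weak inequality at \<open>N\<close>; moving on to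
      \<open>Suc N\<close> makes it strict because the slope \<open>k\<close> is positive.\<close>
    have "ereal e \<le> ereal (c + of_nat k * d N)"
      using v_diff[of "poly a (s (Suc N))" "poly a (s N)"] by (simp add: e diff)
    moreover have "of_nat k * d N < of_nat k * d (Suc N)" using k by simp
    ultimately have "v (poly a (s (Suc N))) < v (poly a (s m) - poly a (s (Suc N)))" if "Suc N < m" for m
      using that by (simp add: e diff)
    moreover have "poly a (s (Suc N)) \<noteq> 0" using e[of "Suc N"] by auto
    ultimately show ?thesis
      by (intro exI[of _ "poly a (s (Suc N))"] conjI eventually_mono[OF eventually_gt_at_top[of "Suc N"]])
  qed
  then obtain x where x: "x \<noteq> 0" "\<forall>\<^sub>F m in sequentially. v x < v (poly a (s m) - x)" by blast
  define u where "u = of_poly (Polynomial.smult (inverse x) a)"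
  have "u - 1 = of_poly (Polynomial.smult (inverse x) a - 1)"
    by (simp add: u_def One_fract_def)
  then have "val (u - 1) m = v ((poly a (s m) - x) / x)" for m
    using x(1) by (simp add: val_poly divide_simps)
  moreover have "\<forall>\<^sub>F m in sequentially. 0 < v ((poly a (s m) - x) / x)"
    using x(2)
  proof eventually_elim
    case (elim m)
    moreover obtain r where "v x = ereal r" using v_real x(1) by blast
    ultimately show ?case using x(1) by (cases "v (poly a (s m) - x)") (auto simp: v_divide)
  qed
  ultimately have "u \<in> U1" by (simp add: U1_def m_E_def)
  moreover have "of_poly a = const_fract x * u"
    using x(1) by (simp add: u_def const_fract_def eq_fract)
  ultimately show ?thesis using x(1) by blast
qed

text \<open>Induction over division with remainder, \<open>f = q * g + a\<close>. By the induction
  hypothesis \<open>q * g\<close> has positive slope, while \<open>a\<close> has slope 0 by the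
  preceding lemma. Their quotient or its inverse therefore lies in \<open>m_E\<close>, and the
  dominated summand is absorbed into a 1-unit.\<close>

lemma poly_decomposition:
  "f \<noteq> 0 \<Longrightarrow> \<exists>x u j. x \<noteq> 0 \<and> u \<in> U1 \<and> of_poly f = const_fract x * u * of_poly q ^ j"
proof (induction "Polynomial.degree f" arbitrary: f rule: less_induct)
  case less
  define g where "g = f div q"
  define a where "a = f mod q"
  have f: "of_poly f = of_poly q * of_poly g + of_poly a" by (simp add: g_def a_def)
  have a: "a = 0 \<or> Polynomial.degree a < Polynomial.degree q"
    unfolding a_def using q_nonzero by (metis degree_mod_less)
  obtain \<gamma> k where q: "1 \<le> k" "asym (of_poly q) \<gamma> k" using asym_q by blast
  have IH: "\<exists>x u j. x \<noteq> 0 \<and> u \<in> U1 \<and> of_poly g = const_fract x * u * of_poly q ^ j" if "g \<noteq> 0"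
  proof (rule less.hyps[OF _ that])
    show "Polynomial.degree g < Polynomial.degree f"
      unfolding g_def
    proof (rule degree_div_less[OF _ degree_q])
      show "0 < Polynomial.degree f"
        using that degree_q div_poly_less[of f q] unfolding g_def by (cases "Polynomial.degree f") auto
    qed
  qed
  consider "g = 0" | "g \<noteq> 0" "a = 0" | "g \<noteq> 0" "a \<noteq> 0" by blast
  then show ?case
  proof cases
    case 1
    with f have "of_poly f = of_poly a" by (simp add: fract_collapse)
    moreover from this less.prems have "a \<noteq> 0" by (auto simp: eq_fract)
    ultimately show ?thesis using residue_of_small_degree[of a] a
      by (metis mult.right_neutral power_0)
  next
    case 2
    then obtain x u j where "x \<noteq> 0" "u \<in> U1" "of_poly g = const_fract x * u * of_poly q ^ j"
      using IH by blast
    with f 2 have "of_poly f = const_fract x * u * of_poly q ^ Suc j" by (simp add: fract_collapse)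
    with \<open>x \<noteq> 0\<close> \<open>u \<in> U1\<close> show ?thesis by blast
  next
    case 3
    then obtain x u j where x: "x \<noteq> 0" and u: "u \<in> U1"
      and g: "of_poly g = const_fract x * u * of_poly q ^ j"
      using IH by blast
    obtain y w where y: "y \<noteq> 0" and w: "w \<in> U1" and a': "of_poly a = const_fract y * w"
      using residue_of_small_degree[of a] a 3 by blast
    obtain r t where r: "v x = ereal r" and t: "v y = ereal t" using v_real x y by blast
    have qg: "asym (of_poly q * of_poly g) (\<gamma> + (r + 0 + of_nat j * \<gamma>)) (k + (0 + 0 + of_nat j * k))"
      unfolding g by (intro asym_mult asym_power asym_const r U1_asym u q)
    moreover have aa: "asym (of_poly a) (t + 0) (0 + 0)"
      unfolding a' by (intro asym_mult asym_const t U1_asym w)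
    ultimately have
      "asym (of_poly q * of_poly g / of_poly a) (\<gamma> + (r + 0 + of_nat j * \<gamma>) - (t + 0)) (k + (0 + 0 + of_nat j * k) - (0 + 0))"
      by (rule asym_divide)
    moreover have "k + int j * k \<noteq> 0" using q(1) by (simp add: add_pos_nonneg less_imp_neq[symmetric])
    ultimately consider "of_poly q * of_poly g / of_poly a \<in> m_E" | "of_poly a / (of_poly q * of_poly g) \<in> m_E"
      using asym_dichotomy by fastforce
    moreover have factor: "A + B = B * (1 + A / B)" "A + B = A * (1 + B / A)"
      if "A \<noteq> 0" "B \<noteq> 0" for A B :: "'a poly fract"
      using that by (simp_all add: distrib_left)
    ultimately show ?thesis
    proof cases
      case 1
      then have "1 + of_poly q * of_poly g / of_poly a \<in> U1" (is "?e \<in> U1") by (simp add: U1_def)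
      moreover have "of_poly f = of_poly a * ?e"
        unfolding f by (rule factor[OF asym_nonzero[OF qg] asym_nonzero[OF aa]])
      then have "of_poly f = const_fract y * (w * ?e) * of_poly q ^ 0"
        by (simp only: a' power_0 mult_1_right mult.assoc)
      ultimately show ?thesis using y U1_mult[OF w] by blast
    next
      case 2
      then have "1 + of_poly a / (of_poly q * of_poly g) \<in> U1" (is "?e \<in> U1") by (simp add: U1_def)
      moreover have "of_poly f = of_poly q * of_poly g * ?e"
        unfolding f by (rule factor[OF asym_nonzero[OF qg] asym_nonzero[OF aa]])
      then have "of_poly f = const_fract x * (u * ?e) * of_poly q ^ Suc j"
        unfolding g by (simp only: power_Suc mult_ac)
      ultimately show ?thesis using x U1_mult[OF u] by blast
    qed
  qed
qed

lemma decomposition: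
  assumes "\<phi> \<noteq> 0"
  shows "\<exists>x u i. x \<noteq> 0 \<and> u \<in> U1 \<and> \<phi> = const_fract x * u * of_poly q powi i"
proof -
  obtain f g where \<phi>: "\<phi> = Fraction_Field.Fract f g" "g \<noteq> 0" by (cases \<phi>)
  with assms have "f \<noteq> 0" by (auto simp: fract_collapse)
  then obtain x u j where x: "x \<noteq> 0" "u \<in> U1" and f: "of_poly f = const_fract x * u * of_poly q ^ j"
    using poly_decomposition by blast
  obtain y w i where y: "y \<noteq> 0" "w \<in> U1" and g: "of_poly g = const_fract y * w * of_poly q ^ i"
    using poly_decomposition[OF \<phi>(2)] by blast
  have "of_poly q \<noteq> 0" using q_nonzero by (simp add: eq_fract Zero_fract_def)
  have "\<phi> = of_poly f / of_poly g" by (simp add: \<phi>)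
  also have "\<dots> = const_fract (x / y) * (u * inverse w) * of_poly q powi (int j - int i)"
    using y(1) \<open>of_poly q \<noteq> 0\<close>
    by (simp add: f g divide_inverse const_mult const_inverse power_int_diff mult_ac)
  finally show ?thesis
    using x y U1_mult[OF x(2) U1_inverse[OF y(2)]] by (metis divide_eq_0_iff)
qed

lemma exists_asym:
  assumes "\<phi> \<noteq> 0"
  shows "\<exists>c k. asym \<phi> c k"
proof -
  obtain x u i where x: "x \<noteq> 0" and u: "u \<in> U1" and \<phi>: "\<phi> = const_fract x * u * of_poly q powi i"
    using decomposition[OF assms] by blast
  obtain r where r: "v x = ereal r" using v_real x by blast
  obtain \<gamma> k where q: "asym (of_poly q) \<gamma> k" using asym_q by blast
  show ?thesis
    unfolding \<phi> using asym_mult[OF asym_mult[OF asym_const[OF r] U1_asym[OF u]] asym_power_int[OF q]] by blast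
qed

text \<open>In the decomposition the power of \<open>q\<close> contributes slope
  \<open>i * k\<close> with \<open>k \<ge> 1\<close>. Uniqueness of the line forces
  \<open>i = 0\<close> and then value 0 of the constant.\<close>

lemma residue_of_unit:
  assumes "\<forall>\<^sub>F n in sequentially. val \<phi> n = 0"
  shows "\<exists>x u. v x = 0 \<and> u \<in> U1 \<and> \<phi> = const_fract x * u"
proof -
  have \<phi>0: "asym \<phi> 0 0" using assms by (simp add: asym_def zero_ereal_def)
  then obtain x u i where x: "x \<noteq> 0" and u: "u \<in> U1" and \<phi>: "\<phi> = const_fract x * u * of_poly q powi i"
    using decomposition asym_nonzero by blast
  obtain r where r: "v x = ereal r" using v_real x by blast
  obtain \<gamma> k where q: "1 \<le> k" "asym (of_poly q) \<gamma> k" using asym_q by blast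
  have "asym \<phi> (r + 0 + of_int i * \<gamma>) (0 + 0 + i * k)"
    unfolding \<phi> by (intro asym_mult asym_const r U1_asym u asym_power_int q)
  from asym_unique[OF this \<phi>0] q(1) have "i = 0" "r = 0" by auto
  with r u \<phi> show ?thesis by (auto simp: zero_ereal_def)
qed

end

text \<open>The zero polynomial has the constant value \<infinity>; if every nonzero polynomial were
  stable, the sequence would be of transcendental type. So a non-stable nonzero polynomial exists
  and can be chosen of least degree.\<close>

lemma (in pseudo_convergent_sequence) exists_key_polynomial:
  assumes "\<not> transcendental_type v s"
  shows "\<exists>q. key_polynomial v s q"
proof -
  have "\<exists>f. f \<noteq> 0 \<and> \<not> stable f"
  proof (rule ccontr)
    assume "\<not> ?thesis"
    then have "\<exists>c. \<forall>\<^sub>F n in sequentially. v (poly f (s n)) = c" for f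
      by (cases "f = 0") (auto simp: stable_def)
    with assms show False by (auto simp: transcendental_type_def)
  qed
  then obtain q where q: "q \<noteq> 0 \<and> \<not> stable q"
    and "\<And>g. g \<noteq> 0 \<and> \<not> stable g \<Longrightarrow> Polynomial.degree q \<le> Polynomial.degree g"
    using exists_least_iff[of "\<lambda>n. \<exists>f. (f \<noteq> 0 \<and> \<not> stable f) \<and> Polynomial.degree f = n"]
    by (metis (no_types, lifting) not_less)
  then have "key_polynomial v s q" by unfold_locales (auto simp: not_less[symmetric])
  then show ?thesis ..
qed

lemma (in pseudo_convergent_sequence) algebraic_not_transcendental:
  assumes "algebraic_type v s"
  shows "\<not> transcendental_type v s"
proof
  assume "transcendental_type v s"
  moreover from assms obtain f where
    f: "\<forall>\<^sub>F n in sequentially. v (poly f (s n)) < v (poly f (s (Suc n)))"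
    unfolding algebraic_type_def by blast
  ultimately obtain c where "\<forall>\<^sub>F n in sequentially. v (poly f (s n)) = c"
    unfolding transcendental_type_def by blast
  then have "\<forall>\<^sub>F n in sequentially. v (poly f (s n)) = c \<and> v (poly f (s (Suc n))) = c"
    by (intro eventually_conj) (simp_all add: eventually_sequentially_Suc[of "\<lambda>n. v (poly f (s n)) = c"])
  with f have "\<forall>\<^sub>F n in sequentially. False" by eventually_elim auto
  then show False by simp
qed

section \<open>Rank\<close>

context pseudo_convergent_sequence
begin

lemma asym_0_0_iff: "asym \<phi> 0 0 \<longleftrightarrow> (\<forall>\<^sub>F n in sequentially. val \<phi> n = 0)"
  by (simp add: asym_def zero_ereal_def)

lemma V_E_cases:
  assumes "\<phi> \<in> V_E v s" "asym \<phi> c k"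
  shows "\<phi> \<in> m_E \<or> asym \<phi> 0 0"
  using assms(2)
proof (cases rule: asym_cases)
  case 2
  with assms(1)[unfolded V_E_iff] have "\<forall>\<^sub>F n in sequentially. False" by eventually_elim simp
  then show ?thesis by simp
qed (auto simp: m_E_def asym_0_0_iff)

lemma V_E_constant_iff:
  assumes "asym \<phi> c 0"
  shows "\<phi> \<in> V_E v s \<longleftrightarrow> 0 \<le> c"
proof -
  have "\<forall>\<^sub>F n in sequentially. 0 \<le> val \<phi> n \<longleftrightarrow> 0 \<le> c"
    using assms unfolding asym_def by eventually_elim simp
  then have "\<phi> \<in> V_E v s \<longleftrightarrow> (\<forall>\<^sub>F n :: nat in sequentially. 0 \<le> c)"
    unfolding V_E_iff by (rule eventually_subst)
  then show ?thesis by simp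
qed

text \<open>The elements of \<open>V_E v s\<close> outside \<open>m_E\<close> are those of eventual
  value 0, and these are closed under products.\<close>

lemma primeideal_m_E:
  assumes tot: "\<And>\<phi>. \<phi> \<noteq> 0 \<Longrightarrow> \<exists>c k. asym \<phi> c k"
  shows "primeideal m_E (ring_on (V_E v s))"
proof -
  have "a \<in> m_E \<or> b \<in> m_E" if ab: "a \<in> V_E v s" "b \<in> V_E v s" "a * b \<in> m_E" for a b
  proof (rule ccontr)
    assume *: "\<not> ?thesis"
    then have "a \<noteq> 0" "b \<noteq> 0" using zero_in_m_E by auto
    with * have "asym a 0 0" "asym b 0 0" using V_E_cases tot ab by blast+
    from asym_mult[OF this] have "\<forall>\<^sub>F n in sequentially. val (a * b) n = 0"
      by (simp add: asym_0_0_iff)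
    with ab(3)[unfolded m_E_def mem_Collect_eq] have "\<forall>\<^sub>F n in sequentially. False"
      by eventually_elim simp
    then show False by simp
  qed
  then show ?thesis
    unfolding primeideal_ring_on_iff[OF subring_V_E]
    using m_E_subset zero_in_m_E m_E_add m_E_mult one_notin_m_E by blast
qed

lemma tendsto_w_E:
  assumes "val \<phi> \<longlonglongrightarrow> l"
  shows "w_E v s \<phi> = l"
  using assms limI unfolding w_E_def val_def by blast

text \<open>The general limit criterion without rescaling; nontriviality is inherited from constants
  of \<open>K\<close>.\<close>

lemma rank_one_valuation_w_E:
  assumes "\<And>\<phi>. \<phi> \<noteq> 0 \<Longrightarrow> \<exists>l::real. val \<phi> \<longlonglongrightarrow> ereal l"
  shows "rank_one_valuation (w_E v s)"
proof -
  obtain x where x: "x \<noteq> 0" "v x \<noteq> 0" using v_nontrivial by blast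
  show ?thesis
  proof (rule rank_one_valuation_limit[where e = "\<lambda>_. 1" and \<phi>\<^sub>0 = "const_fract x"])
    show "(\<lambda>n. val \<phi> n * ereal 1) \<longlonglongrightarrow> w_E v s \<phi>" for \<phi>
    proof (cases "\<phi> = 0")
      case True
      moreover have "val 0 = (\<lambda>_. \<infinity>)" by (simp add: fun_eq_iff val_0)
      ultimately show ?thesis using tendsto_w_E[of 0 \<infinity>] by simp
    next
      case False
      then show ?thesis using assms[of \<phi>] tendsto_w_E by (auto simp flip: one_ereal_def)
    qed
    show "\<bar>w_E v s \<phi>\<bar> \<noteq> \<infinity>" if "\<phi> \<noteq> 0" for \<phi>
      using assms[OF that] tendsto_w_E by fastforce
    show "w_E v s (const_fract x) \<noteq> 0"
    proof -
      have "val (const_fract x) = (\<lambda>_. v x)" by (simp add: fun_eq_iff val_const)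
      then show ?thesis using tendsto_w_E[of "const_fract x" "v x"] x by simp
    qed
  qed (use x in \<open>auto simp: const_eq_0_iff\<close>)
qed

lemma W_E_eq: "W_E v s = valuation_ring (w_E v s)"
  by (simp add: W_E_def valuation_ring_def)

text \<open>All slopes are 0, so each value along the sequence eventually equals its limit, and the
  two membership conditions coincide.\<close>

lemma transcendental_case:
  assumes "transcendental_type v s"
  shows "V_E v s = W_E v s \<and> rank (V_E v s) = 1"
proof -
  have lim: "val \<phi> \<longlonglongrightarrow> ereal c" if "asym \<phi> c 0" for \<phi> c
    using that by (intro tendsto_eventually) (simp add: asym_def)
  interpret w: rank_one_valuation "w_E v s"
    by (rule rank_one_valuation_w_E) (use transcendental_asym[OF assms] lim in blast)
  have "\<phi> \<in> V_E v s \<longleftrightarrow> \<phi> \<in> W_E v s" for \<phi>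
  proof (cases "\<phi> = 0")
    case False
    then obtain c where c: "asym \<phi> c 0" using transcendental_asym[OF assms] by blast
    then show ?thesis using tendsto_w_E[OF lim[OF c]] V_E_constant_iff[OF c] by (simp add: W_E_def)
  qed (simp add: V_E_iff W_E_def val_0)
  then show ?thesis using w.rank_valuation_ring W_E_eq by (metis Set.set_eqI)
qed

end

section \<open>Infinite breadth\<close>

locale key_polynomial_infinite = key_polynomial +
  assumes d_at_top: "filterlim d at_top sequentially"
begin

lemma line_at_top:
  fixes c k :: real
  assumes "0 < k"
  shows "filterlim (\<lambda>n. c + k * d n) at_top sequentially"
  by (intro filterlim_tendsto_add_at_top[OF tendsto_const]
      filterlim_tendsto_pos_mult_at_top[OF tendsto_const] assms d_at_top)

lemma asym_slope_pos:
  assumes "asym \<phi> c k" "0 < k"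
  shows "\<forall>\<^sub>F n in sequentially. 0 < val \<phi> n"
proof -
  have "\<forall>\<^sub>F n in sequentially. 0 < c + of_int k * d n"
    using line_at_top[of "of_int k" c] assms(2) by (simp add: filterlim_at_top_dense)
  with assms(1)[unfolded asym_def] show ?thesis by eventually_elim simp
qed

lemma asym_slope_neg:
  assumes "asym \<phi> c k" "k < 0"
  shows "\<forall>\<^sub>F n in sequentially. val \<phi> n < 0"
  using asym_slope_pos[OF asym_inverse[OF assms(1)]] assms(2)
    eventually_val_inverse[OF asym_nonzero[OF assms(1)]]
  by (auto elim: eventually_elim2)

text \<open>Since \<open>d\<close> tends to infinity, the sign of \<open>c + k * d n\<close> is
  decided by \<open>k\<close>, and by \<open>c\<close> only if \<open>k = 0\<close>. Thus
  \<open>V_E v s\<close> belongs to the lexicographically ordered pairs \<open>(k, c)\<close>, which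
  is the source of rank two.\<close>

lemma V_E_asym_iff:
  assumes "asym \<phi> c k"
  shows "\<phi> \<in> V_E v s \<longleftrightarrow> 0 < k \<or> k = 0 \<and> 0 \<le> c"
proof -
  consider "0 < k" | "k = 0" | "k < 0" by linarith
  then show ?thesis
  proof cases
    case 1
    then show ?thesis using asym_slope_pos[OF assms] by (auto simp: V_E_iff elim: eventually_mono)
  next
    case 2
    with V_E_constant_iff[of \<phi> c] assms show ?thesis by simp
  next
    case 3
    have "\<phi> \<notin> V_E v s"
    proof
      assume "\<phi> \<in> V_E v s"
      with asym_slope_neg[OF assms 3] have "\<forall>\<^sub>F n in sequentially. False"
        unfolding V_E_iff by eventually_elim simp
      then show False by simp
    qed
    with 3 show ?thesis by simp
  qed
qed

lemma m_E_asym_iff: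
  assumes "asym \<phi> c k"
  shows "\<phi> \<in> m_E \<longleftrightarrow> 0 < k \<or> k = 0 \<and> 0 < c"
proof -
  have "\<phi> \<in> m_E \<longleftrightarrow> \<phi> \<in> V_E v s \<and> \<not> asym \<phi> 0 0"
  proof
    assume m: "\<phi> \<in> m_E"
    have "\<not> asym \<phi> 0 0"
    proof
      assume "asym \<phi> 0 0"
      with m have "\<forall>\<^sub>F n in sequentially. False"
        unfolding m_E_def mem_Collect_eq asym_0_0_iff by eventually_elim simp
      then show False by simp
    qed
    with m m_E_subset show "\<phi> \<in> V_E v s \<and> \<not> asym \<phi> 0 0" by blast
  qed (use V_E_cases[OF _ assms] in blast)
  also have "asym \<phi> 0 0 \<longleftrightarrow> c = 0 \<and> k = 0" using assms asym_unique by blast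
  finally show ?thesis using V_E_asym_iff[OF assms] by auto
qed

text \<open>The dominant coordinate of the pair of \<open>asym\<close>; it takes extended real
  values so that it can be treated as a rank one valuation on \<open>K(X)\<close>.\<close>

definition slope :: "'a poly fract \<Rightarrow> ereal" where
  "slope \<phi> = (if \<phi> = 0 then \<infinity> else ereal (of_int (THE k. \<exists>c. asym \<phi> c k)))"

lemma slope_asym: "asym \<phi> c k \<Longrightarrow> slope \<phi> = ereal (of_int k)"
  unfolding slope_def using asym_nonzero asym_unique by (auto intro!: the_equality)

text \<open>The slope is the limit of \<open>val \<phi> n / d n\<close>, which equals
  \<open>c / d n + k\<close> for large \<open>n\<close>. The limit criterion applies with the
  scaling \<open>1 / d n\<close>, and \<open>q\<close> has nonzero slope.\<close>

sublocale slope: rank_one_valuation slope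
proof -
  obtain \<gamma> k where q: "1 \<le> k" "asym (of_poly q) \<gamma> k" using asym_q by blast
  show "rank_one_valuation slope"
  proof (rule rank_one_valuation_limit[where e = "\<lambda>n. 1 / d n" and \<phi>\<^sub>0 = "of_poly q"])
    have d_pos: "\<forall>\<^sub>F n in sequentially. 0 < d n" using d_at_top by (simp add: filterlim_at_top_dense)
    then show e_pos: "\<forall>\<^sub>F n in sequentially. 0 < 1 / d n" by eventually_elim simp
    show "(\<lambda>n. val \<phi> n * ereal (1 / d n)) \<longlonglongrightarrow> slope \<phi>" for \<phi>
    proof (cases "\<phi> = 0")
      case True
      show ?thesis
        by (rule tendsto_eventually, use e_pos in eventually_elim) (simp add: True val_0 slope_def)
    next
      case False
      then obtain c k where a: "asym \<phi> c k" using exists_asym by blast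
      have "(\<lambda>n. c / d n + of_int k) \<longlonglongrightarrow> 0 + of_int k"
        by (intro tendsto_intros tendsto_divide_0[OF tendsto_const]
            filterlim_at_top_imp_at_infinity d_at_top)
      then have "(\<lambda>n. ereal (c / d n + of_int k)) \<longlonglongrightarrow> slope \<phi>" by (simp add: slope_asym[OF a])
      moreover have "\<forall>\<^sub>F n in sequentially. ereal (c / d n + of_int k) = val \<phi> n * ereal (1 / d n)"
        using d_pos a[unfolded asym_def] by eventually_elim (simp add: add_divide_distrib)
      ultimately show ?thesis by (rule Lim_transform_eventually)
    qed
    show "\<bar>slope \<phi>\<bar> \<noteq> \<infinity>" if "\<phi> \<noteq> 0" for \<phi> using that by (simp add: slope_def)
    show "of_poly q \<noteq> 0" using q(2) by (rule asym_nonzero)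
    show "slope (of_poly q) \<noteq> 0" using slope_asym[OF q(2)] q(1) by simp
  qed
qed

lemma V_E_subset_slope: "V_E v s \<subseteq> valuation_ring slope"
proof
  fix \<phi> assume "\<phi> \<in> V_E v s"
  then show "\<phi> \<in> valuation_ring slope"
    using exists_asym[of \<phi>] V_E_asym_iff slope_asym
    by (cases "\<phi> = 0") (fastforce simp: valuation_ring_def)+
qed

lemma slope_pos_subset: "{\<phi>. 0 < slope \<phi>} \<subseteq> m_E"
proof
  fix \<phi> assume "\<phi> \<in> {\<phi>. 0 < slope \<phi>}"
  then show "\<phi> \<in> m_E"
    using exists_asym[of \<phi>] m_E_asym_iff slope_asym zero_in_m_E by (cases "\<phi> = 0") fastforce+
qed

text \<open>A nonzero prime contains every \<open>y\<close> of \<open>V_E v s\<close> some power of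
  which is a multiple of a given nonzero member. This yields first all elements of positive slope.
  If the prime also has a member of slope 0, the Archimedean property of the values \<open>c\<close>
  yields the rest of \<open>m_E\<close>.\<close>

lemma primeideal_V_E_iff:
  "primeideal P (ring_on (V_E v s)) \<longleftrightarrow> P = {0} \<or> P = {\<phi>. 0 < slope \<phi>} \<or> P = m_E"
proof
  assume P: "primeideal P (ring_on (V_E v s))"
  note * = P[unfolded primeideal_ring_on_iff[OF subring_V_E]]
  have P_m: "P \<subseteq> m_E"
  proof
    fix x assume x: "x \<in> P"
    show "x \<in> m_E"
    proof (rule ccontr)
      assume "x \<notin> m_E"
      with zero_in_m_E obtain c k where "asym x c k" using exists_asym by metis
      then have x0: "asym x 0 0" using V_E_cases \<open>x \<notin> m_E\<close> x * by blast
      then have "inverse x \<in> V_E v s" using V_E_asym_iff[OF asym_inverse] by fastforce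
      with * x have "inverse x * x \<in> P" by blast
      with * asym_nonzero[OF x0] show False by simp
    qed
  qed
  have power: "y \<in> P" if "x \<in> P" "x \<noteq> 0" "y \<in> V_E v s" "y ^ n / x \<in> V_E v s" for x y n
  proof -
    from that * have "(y ^ n / x) * x \<in> P" by blast
    with that have "y ^ n \<in> P" by simp
    then show ?thesis using primeideal_powerD[OF subring_V_E P] that by blast
  qed
  show "P = {0} \<or> P = {\<phi>. 0 < slope \<phi>} \<or> P = m_E"
  proof (cases "P = {0}")
    case False
    with * obtain x where x: "x \<in> P" "x \<noteq> 0" by blast
    then obtain c k where xa: "asym x c k" using exists_asym by blast
    with x P_m m_E_asym_iff have k: "0 \<le> k" by fastforce
    have slope_P: "{\<phi>. 0 < slope \<phi>} \<subseteq> P"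
    proof
      fix y assume y: "y \<in> {\<phi>. 0 < slope \<phi>}"
      show "y \<in> P"
      proof (cases "y = 0")
        case False
        then obtain c' k' where ya: "asym y c' k'" using exists_asym by blast
        with y have k': "1 \<le> k'" by (simp add: slope_asym)
        \<comment> \<open>With \<open>k \<ge> 0\<close> and \<open>k' \<ge> 1\<close> the exponent
          \<open>k + 1\<close> leaves slope \<open>(k + 1) * k' - k \<ge> 1\<close>, so the
          intercepts do not matter.\<close>
        have "asym (y ^ nat (k + 1) / x) (of_nat (nat (k + 1)) * c' - c) (of_nat (nat (k + 1)) * k' - k)"
          by (intro asym_divide asym_power xa ya)
        moreover have "0 < (k + 1) * k' - k" using k k' by (smt (verit) mult_le_cancel_left1)
        ultimately have "y ^ nat (k + 1) / x \<in> V_E v s" using V_E_asym_iff k by fastforce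
        with x show ?thesis using power y slope_pos_subset m_E_subset by blast
      qed (use * in simp)
    qed
    show ?thesis
    proof (cases "P \<subseteq> {\<phi>. 0 < slope \<phi>}")
      case True
      with slope_P show ?thesis by blast
    next
      case False
      then obtain z where z: "z \<in> P" "\<not> 0 < slope z" by blast
      then have "z \<noteq> 0" by auto
      then obtain b l where za: "asym z b l" using exists_asym by blast
      with z P_m m_E_asym_iff have zb: "l = 0" by (fastforce simp: slope_asym)
      have "m_E \<subseteq> P"
      proof
        fix y assume y: "y \<in> m_E"
        show "y \<in> P"
        proof (cases "0 < slope y")
          case False
          then have "y \<noteq> 0" by auto
          then obtain c' k' where ya: "asym y c' k'" using exists_asym by blast
          with y False have k': "k' = 0" "0 < c'" using m_E_asym_iff by (fastforce simp: slope_asym)+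
          then obtain n where n: "b < of_nat n * c'" using reals_Archimedean3 by blast
          have "asym (y ^ n / z) (of_nat n * c' - b) (of_nat n * k' - l)"
            by (intro asym_divide asym_power za ya)
          then have "y ^ n / z \<in> V_E v s" using V_E_asym_iff n k' zb by fastforce
          then show ?thesis using power z \<open>z \<noteq> 0\<close> y m_E_subset by blast
        qed (use slope_P in blast)
      qed
      with P_m show ?thesis by blast
    qed
  qed simp
next
  have "primeideal {0} (ring_on (V_E v s))"
    unfolding primeideal_ring_on_iff[OF subring_V_E] by (auto simp: V_E_iff val_0)
  moreover have "primeideal {\<phi>. 0 < slope \<phi>} (ring_on (V_E v s))"
    using slope.primeideal_positive[OF subring_V_E V_E_subset_slope] slope_pos_subset m_E_subset by blast
  moreover have "primeideal m_E (ring_on (V_E v s))"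
    using exists_asym by (rule primeideal_m_E)
  moreover assume "P = {0} \<or> P = {\<phi>. 0 < slope \<phi>} \<or> P = m_E"
  ultimately show "primeideal P (ring_on (V_E v s))" by blast
qed

lemma slope_pos_psubset: "{\<phi>. 0 < slope \<phi>} \<subset> m_E"
proof -
  obtain x where x: "0 < v x" "x \<noteq> 0" using exists_pos by blast
  then obtain c where "v x = ereal c" using v_real by blast
  from asym_const[OF this] have "slope (const_fract x) = 0" by (simp add: slope_asym zero_ereal_def)
  moreover have "const_fract x \<in> m_E" using x by (simp add: m_E_def val_const)
  ultimately show ?thesis using slope_pos_subset by force
qed

lemma rank_V_E: "rank (V_E v s) = 2"
proof -
  define P where "P i = (if i = 0 then {0} else if i = 1 then {\<phi>. 0 < slope \<phi>} else m_E)" for i :: nat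
  have "krull_dim (ring_on (V_E v s)) = enat 2"
  proof (rule krull_dim_eq[where P = P])
    have "{..2::nat} = {0, 1, 2}" by auto
    then have "P ` {..2} = {{0}, {\<phi>. 0 < slope \<phi>}, m_E}" by (auto simp: P_def)
    then show "primeideal Q (ring_on (V_E v s)) \<longleftrightarrow> Q \<in> P ` {..2}" for Q
      by (simp only: primeideal_V_E_iff) blast
    fix i :: nat assume "i < 2"
    moreover have "{0} \<subset> {\<phi>. 0 < slope \<phi>}" using slope.exists_pos by auto
    ultimately show "P i \<subset> P (Suc i)" using slope_pos_psubset by (cases i) (auto simp: P_def)
  qed
  then show ?thesis by (simp add: rank_def numeral_eq_enat)
qed

text \<open>A member \<open>\<phi>\<close> of \<open>R\<close> outside \<open>V_E v s\<close> has
  negative pair \<open>(k, c)\<close>, so dividing by its powers moves elements into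
  \<open>V_E v s\<close>. Any such \<open>\<phi>\<close> captures all elements of nonnegative slope;
  a \<open>\<phi>\<close> of negative slope captures the whole field.\<close>

lemma overrings_V_E:
  assumes "R \<in> overrings (V_E v s)"
  shows "R = V_E v s \<or> R = valuation_ring slope \<or> R = UNIV"
proof (cases "R = V_E v s")
  case False
  note R = subring_ring_onD[of R]
  from assms have sub: "subring R (ring_on UNIV)" and VR: "V_E v s \<subseteq> R" by (auto simp: overrings_def)
  have quot: "\<psi> \<in> R" if "\<phi> \<in> R" "\<phi> \<noteq> 0" "\<psi> / \<phi> ^ n \<in> V_E v s" for \<phi> \<psi> n
  proof -
    have "(\<psi> / \<phi> ^ n) * \<phi> ^ n \<in> R" using that VR R(4,7)[OF sub] by blast
    with that show ?thesis by simp
  qed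
  from False VR obtain \<phi> where \<phi>: "\<phi> \<in> R" "\<phi> \<notin> V_E v s" by blast
  then have "\<phi> \<noteq> 0" by (auto simp: V_E_iff val_0)
  then obtain c k where \<phi>a: "asym \<phi> c k" using exists_asym by blast
  have sR: "valuation_ring slope \<subseteq> R"
  proof
    fix \<psi> assume \<psi>: "\<psi> \<in> valuation_ring slope"
    show "\<psi> \<in> R"
    proof (cases "\<psi> = 0")
      case False
      then obtain c' k' where \<psi>a: "asym \<psi> c' k'" using exists_asym by blast
      with \<psi> have k': "0 \<le> k'" by (simp add: valuation_ring_def slope_asym)
      have a: "asym (\<psi> / \<phi> ^ n) (c' - of_nat n * c) (k' - of_nat n * k)" for n
        by (intro asym_divide asym_power \<phi>a \<psi>a)
      have "\<exists>n. \<psi> / \<phi> ^ n \<in> V_E v s"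
      proof (cases "k < 0")
        case True
        then show ?thesis using k' V_E_asym_iff[OF a[of 1]] by (intro exI[of _ 1]) auto
      next
        case False
        with \<phi>(2) V_E_asym_iff[OF \<phi>a] have "k = 0" "0 < - c" by auto
        then obtain n where "- c' < of_nat n * - c" using reals_Archimedean3 by blast
        then show ?thesis using k' \<open>k = 0\<close> V_E_asym_iff[OF a[of n]] by (intro exI[of _ n]) auto
      qed
      then show ?thesis using quot \<phi>(1) \<open>\<phi> \<noteq> 0\<close> by blast
    qed (use R(1)[OF sub] in simp)
  qed
  show ?thesis
  proof (cases "R \<subseteq> valuation_ring slope")
    case False
    then obtain \<phi> where \<phi>: "\<phi> \<in> R" "\<phi> \<notin> valuation_ring slope" by blast
    then have "\<phi> \<noteq> 0" by (auto simp: valuation_ring_def)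
    then obtain c k where \<phi>a: "asym \<phi> c k" using exists_asym by blast
    with \<phi>(2) have k: "k \<le> - 1" by (simp add: valuation_ring_def slope_asym)
    have "\<psi> \<in> R" for \<psi>
    proof (cases "\<psi> = 0")
      case False
      then obtain c' k' where \<psi>a: "asym \<psi> c' k'" using exists_asym by blast
      \<comment> \<open>As \<open>k \<le> - 1\<close>, this exponent raises the slope of
        \<open>\<psi> / \<phi> ^ n\<close> to at least 1.\<close>
      define n where "n = nat (\<bar>k'\<bar> + 1)"
      have "\<bar>k'\<bar> + 1 \<le> - (of_nat n * k)"
        using k mult_left_mono[of 1 "- k" "int n"] by (simp add: n_def)
      then have "0 < k' - of_nat n * k" by linarith
      moreover have "asym (\<psi> / \<phi> ^ n) (c' - of_nat n * c) (k' - of_nat n * k)"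
        by (intro asym_divide asym_power \<phi>a \<psi>a)
      ultimately show ?thesis using quot[OF \<phi>(1) \<open>\<phi> \<noteq> 0\<close>] V_E_asym_iff by blast
    qed (use R(1)[OF sub] in simp)
    then show ?thesis by blast
  qed (use sR in blast)
qed simp

text \<open>The three overrings \<open>V_E v s\<close>, \<open>valuation_ring slope\<close> and
  \<open>UNIV\<close> have dimensions 2, 1 and 0.\<close>

lemma one_dimensional_overrings:
  "{R \<in> overrings (V_E v s). krull_dim (ring_on R) = 1} = {valuation_ring slope}"
proof -
  have "krull_dim (ring_on (valuation_ring slope)) = 1"
    using slope.rank_valuation_ring by (simp add: rank_def)
  moreover have "valuation_ring slope \<in> overrings (V_E v s)"
    using slope.subring_valuation_ring V_E_subset_slope by (simp add: overrings_def)
  moreover have "krull_dim (ring_on (V_E v s)) \<noteq> 1"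
    using rank_V_E by (simp add: rank_def one_enat_def numeral_eq_enat)
  moreover have "krull_dim (ring_on (UNIV :: 'a poly fract set)) \<noteq> 1"
    by (simp add: krull_dim_UNIV_field)
  ultimately show ?thesis using overrings_V_E by auto
qed

text \<open>The decomposition of a polynomial involves only a natural power of \<open>q\<close>,
  whose slope is positive.\<close>

lemma slope_poly_nonneg: "0 \<le> slope (of_poly f)"
proof (cases "f = 0")
  case False
  then obtain x u j where x: "x \<noteq> 0" and u: "u \<in> U1" and f: "of_poly f = const_fract x * u * of_poly q ^ j"
    using poly_decomposition by blast
  obtain r where r: "v x = ereal r" using v_real x by blast
  obtain \<gamma> k where q: "1 \<le> k" "asym (of_poly q) \<gamma> k" using asym_q by blast
  have "asym (of_poly f) (r + 0 + of_nat j * \<gamma>) (0 + 0 + of_nat j * k)"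
    unfolding f by (intro asym_mult asym_const r U1_asym u asym_power q)
  then show ?thesis using q(1) by (simp add: slope_asym)
qed (simp add: fract_collapse)

text \<open>Polynomials of positive slope form a prime ideal of \<open>K[X]\<close>, and division
  with remainder shows that \<open>p\<close>, being of least degree, generates it. A fraction of
  nonnegative slope whose denominator is divisible by \<open>p\<close> has its numerator divisible
  too; cancelling \<open>p\<close> repeatedly brings it into the localization.\<close>

lemma poly_localization_eq:
  assumes p: "p \<noteq> 0" "0 < slope (of_poly p)"
    and min: "\<And>f. f \<noteq> 0 \<Longrightarrow> 0 < slope (of_poly f) \<Longrightarrow> Polynomial.degree p \<le> Polynomial.degree f"
  shows "poly_localization p = valuation_ring slope"
proof -
  have dvd: "p dvd f \<longleftrightarrow> 0 < slope (of_poly f)" for f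
  proof
    assume "p dvd f"
    then obtain g where "f = p * g" by (rule dvdE)
    then have "slope (of_poly f) = slope (of_poly p) + slope (of_poly g)"
      using slope.v_mult[of "of_poly p" "of_poly g"] by simp
    then show "0 < slope (of_poly f)"
      using p(2) slope_poly_nonneg[of g] by (metis add_pos_nonneg)
  next
    assume f: "0 < slope (of_poly f)"
    have "of_poly (f mod p) = of_poly f - of_poly p * of_poly (f div p)"
      by (simp add: minus_mult_div_eq_mod)
    moreover have "0 < slope (of_poly p * of_poly (f div p))"
      unfolding slope.v_mult by (rule add_pos_nonneg[OF p(2) slope_poly_nonneg])
    ultimately have "0 < slope (of_poly (f mod p))"
      using f slope.v_diff[of "of_poly f" "of_poly p * of_poly (f div p)"]
      by (simp add: min_def split: if_splits)
    then have "f mod p = 0" using min[of "f mod p"] degree_mod_less'[OF p(1), of f] by fastforce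
    then show "p dvd f" by (simp add: dvd_eq_mod_eq_0)
  qed
  \<comment> \<open>Constants have slope 0. Positivity of the degree makes the cancellation of
    \<open>p\<close> terminate.\<close>
  have deg: "0 < Polynomial.degree p"
  proof (rule ccontr)
    assume "\<not> 0 < Polynomial.degree p"
    then obtain x where x: "p = [:x:]" by (auto elim: degree_eq_zeroE)
    with p(1) obtain c where "v x = ereal c" using v_real by auto
    from slope_asym[OF asym_const[OF this]] p(2) x show False by (simp add: const_fract_def)
  qed
  have quotient: "slope (Fraction_Field.Fract f g) = slope (of_poly f) - slope (of_poly g)" if "g \<noteq> 0" for f g
  proof -
    have "of_poly g \<noteq> 0" using that by (simp add: Zero_fract_def eq_fract)
    from slope.v_divide[OF this, of "of_poly f"] show ?thesis by simp
  qed
  have "poly_localization p \<subseteq> valuation_ring slope"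
  proof
    fix \<phi> assume "\<phi> \<in> poly_localization p"
    then obtain f g where \<phi>: "\<phi> = Fraction_Field.Fract f g" "\<not> p dvd g"
      unfolding poly_localization_def by blast
    moreover have "slope (of_poly g) = 0"
    proof (rule antisym)
      show "slope (of_poly g) \<le> 0" using \<phi>(2) unfolding dvd not_less .
    qed (rule slope_poly_nonneg)
    moreover have "g \<noteq> 0" using \<phi>(2) by auto
    ultimately show "\<phi> \<in> valuation_ring slope"
      using slope_poly_nonneg[of f] quotient[of g f] by (simp add: valuation_ring_def)
  qed
  moreover have in_localization: "Fraction_Field.Fract f g \<in> poly_localization p"
    if "g \<noteq> 0" "0 \<le> slope (Fraction_Field.Fract f g)" for f g
    using that
  proof (induction "Polynomial.degree g" arbitrary: f g rule: less_induct)
    case less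
    show ?case
    proof (cases "p dvd g")
      case False
      then show ?thesis unfolding poly_localization_def by blast
    next
      case True
      then have g: "0 < slope (of_poly g)" by (simp add: dvd)
      have "of_poly g \<noteq> 0" using less.prems(1) by (simp add: Zero_fract_def eq_fract)
      then obtain r where "slope (of_poly g) = ereal r" using slope.v_real by blast
      with g quotient[OF less.prems(1), of f] less.prems(2) have "0 < slope (of_poly f)"
        by (cases "slope (of_poly f)") auto
      then have "p dvd f" by (simp add: dvd)
      then obtain f' where f': "f = p * f'" by (rule dvdE)
      obtain g' where g': "g = p * g'" using True by (rule dvdE)
      have "g' \<noteq> 0" using less.prems(1) g' by auto
      then have "Polynomial.degree g' < Polynomial.degree g" using g' p(1) deg by (simp add: degree_mult_eq)
      moreover have "Fraction_Field.Fract f g = Fraction_Field.Fract f' g'"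
        using p(1) by (simp add: f' g' mult_fract_cancel)
      ultimately show ?thesis using less.hyps[of g' f'] less.prems(2) \<open>g' \<noteq> 0\<close> by simp
    qed
  qed
  have "valuation_ring slope \<subseteq> poly_localization p"
  proof
    fix \<phi> assume \<phi>: "\<phi> \<in> valuation_ring slope"
    obtain f g where "\<phi> = Fraction_Field.Fract f g" "g \<noteq> 0" by (cases \<phi>)
    with in_localization \<phi> show "\<phi> \<in> poly_localization p" by (simp add: valuation_ring_def)
  qed
  ultimately show ?thesis by blast
qed

end

section \<open>The limit in the completion\<close>

lemma a_inv_ring_on:
  fixes A :: "'a::comm_ring_1 set"
  assumes "subring A (ring_on UNIV)" "x \<in> A"
  shows "\<ominus>\<^bsub>ring_on A\<^esub> x = - x"
proof -
  interpret cring "ring_on A" by (rule cring_ring_on[OF assms(1)])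
  show ?thesis
    using assms(2) subring_ring_onD(3)[OF assms] by (intro minus_equality) auto
qed

lemma nat_pow_ring_on: "x [^]\<^bsub>ring_on A\<^esub> (n::nat) = (x::'a::comm_ring_1) ^ n"
  by (induction n) (simp_all add: nat_pow_def mult.commute)

lemma finsum_ring_on:
  fixes A :: "'a::comm_ring_1 set"
  assumes A: "subring A (ring_on UNIV)" and f: "f ` I \<subseteq> A" and "finite I"
  shows "finsum (ring_on A) f I = sum f I"
proof -
  interpret cring "ring_on A" by (rule cring_ring_on[OF A])
  show ?thesis
    using assms(3,2)
  proof (induction I rule: finite_induct)
    case (insert i I)
    then have "finsum (ring_on A) f (insert i I) = f i \<oplus>\<^bsub>ring_on A\<^esub> finsum (ring_on A) f I"
      by (intro finsum_insert) auto
    then show ?case using insert by simp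
  qed simp
qed

section \<open>The ring of Cauchy sequences and its quotient by the null sequences\<close>

context rank_one_valuation
begin

lemma v_CauchyD: "v_Cauchy v t \<Longrightarrow> \<exists>N. \<forall>m\<ge>N. \<forall>n\<ge>N. ereal r < v (t m - t n)"
  by (simp add: v_Cauchy_def)

lemma v_Cauchy_bounded:
  assumes "v_Cauchy v t"
  shows "\<exists>b::real. \<forall>\<^sub>F n in sequentially. ereal b \<le> v (t n)"
proof -
  obtain N where N: "\<And>m n. N \<le> m \<Longrightarrow> N \<le> n \<Longrightarrow> ereal 0 < v (t m - t n)"
    using v_CauchyD[OF assms, of 0] by blast
  have "\<exists>b::real. ereal b \<le> v (t N) \<and> b \<le> 0"
  proof (cases "v (t N)")
    case (real r)
    then show ?thesis by (intro exI[of _ "min r 0"]) simp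
  qed (use v_not_MInf in auto)
  then obtain b :: real where b: "ereal b \<le> v (t N)" "b \<le> 0" by blast
  have "ereal b \<le> v (t n)" if "N \<le> n" for n
  proof -
    have "ereal b \<le> ereal 0" using b(2) by simp
    also have "\<dots> \<le> v (t n - t N)" using N[OF that order_refl] by (rule less_imp_le)
    finally have "ereal b \<le> min (v (t N)) (v (t n - t N))" using b(1) by simp
    also have "\<dots> \<le> v (t n)" using v_add[of "t N" "t n - t N"] by simp
    finally show ?thesis .
  qed
  then show ?thesis unfolding eventually_sequentially by blast
qed

lemma v_Cauchy_add:
  assumes "v_Cauchy v t" "v_Cauchy v u"
  shows "v_Cauchy v (t + u)"
  unfolding v_Cauchy_def
proof
  fix r :: real
  obtain M N where MN: "\<And>m n. M \<le> m \<Longrightarrow> M \<le> n \<Longrightarrow> ereal r < v (t m - t n)"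
    "\<And>m n. N \<le> m \<Longrightarrow> N \<le> n \<Longrightarrow> ereal r < v (u m - u n)"
    using assms[THEN v_CauchyD] by metis
  show "\<exists>N. \<forall>m\<ge>N. \<forall>n\<ge>N. ereal r < v ((t + u) m - (t + u) n)"
  proof (intro exI[of _ "max M N"] allI impI)
    fix m n assume "max M N \<le> m" "max M N \<le> n"
    then have "ereal r < v ((t m - t n) + (u m - u n))" by (intro v_add_gt MN) auto
    then show "ereal r < v ((t + u) m - (t + u) n)" by (simp add: algebra_simps)
  qed
qed

lemma v_Cauchy_uminus: "v_Cauchy v t \<Longrightarrow> v_Cauchy v (- t)"
proof -
  have "v (- t m - - t n) = v (t m - t n)" for m n
    using v_diff_commute[of "t m" "t n"] by (simp add: algebra_simps)
  then show "v_Cauchy v t \<Longrightarrow> v_Cauchy v (- t)" by (simp add: v_Cauchy_def)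
qed

lemma v_Cauchy_const: "v_Cauchy v (\<lambda>_. c)"
  by (simp add: v_Cauchy_def)

lemma v_mult_gt:
  assumes "ereal b \<le> v x" "ereal (r - b) < v y"
  shows "ereal r < v (x * y)"
  using assms by (cases "v x"; cases "v y") (auto simp: v_mult)

lemma v_Cauchy_mult:
  assumes "v_Cauchy v t" "v_Cauchy v u"
  shows "v_Cauchy v (t * u)"
  unfolding v_Cauchy_def
proof
  fix r :: real
  obtain b c :: real and B C where bc: "\<And>n. B \<le> n \<Longrightarrow> ereal b \<le> v (t n)" "\<And>n. C \<le> n \<Longrightarrow> ereal c \<le> v (u n)"
    using assms[THEN v_Cauchy_bounded] unfolding eventually_sequentially by metis
  obtain M N where MN: "\<And>m n. M \<le> m \<Longrightarrow> M \<le> n \<Longrightarrow> ereal (r - c) < v (t m - t n)"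
    "\<And>m n. N \<le> m \<Longrightarrow> N \<le> n \<Longrightarrow> ereal (r - b) < v (u m - u n)"
    using assms[THEN v_CauchyD] by metis
  show "\<exists>N. \<forall>m\<ge>N. \<forall>n\<ge>N. ereal r < v ((t * u) m - (t * u) n)"
  proof (intro exI[of _ "max (max M N) (max B C)"] allI impI)
    fix m n assume mn: "max (max M N) (max B C) \<le> m" "max (max M N) (max B C) \<le> n"
    then have "ereal r < v (t m * (u m - u n))"
      by (intro v_mult_gt[where b = b] bc MN) auto
    moreover from mn have "ereal r < v (u n * (t m - t n))"
      by (intro v_mult_gt[where b = c] bc MN) auto
    ultimately have "ereal r < v (t m * (u m - u n) + u n * (t m - t n))" by (rule v_add_gt)
    then show "ereal r < v ((t * u) m - (t * u) n)" by (simp add: algebra_simps)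
  qed
qed

lemma subring_v_Cauchy: "subring {t. v_Cauchy v t} (ring_on UNIV)"
  by (rule subring_ring_onI)
    (auto simp: v_Cauchy_add v_Cauchy_mult v_Cauchy_uminus v_Cauchy_const one_fun_def)

text \<open>The operations are the pointwise ones of the function ring, so the criteria for
  \<open>ring_on\<close> of a subring carry over to Cauchy sequences.\<close>

lemma cauchy_ring_eq: "cauchy_ring v = ring_on {t. v_Cauchy v t}"
  by (simp add: cauchy_ring_def ring_on_def times_fun_def plus_fun_def zero_fun_def one_fun_def fun_eq_iff)

lemma null_seqs_iff: "t \<in> null_seqs v \<longleftrightarrow> (\<forall>r. \<forall>\<^sub>F n in sequentially. ereal r < v (t n))"
  by (simp add: null_seqs_def tendsto_PInfty)

lemma null_seqs_Cauchy: "t \<in> null_seqs v \<Longrightarrow> v_Cauchy v t"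
  unfolding v_Cauchy_def
proof
  fix r :: real
  assume "t \<in> null_seqs v"
  then obtain N where N: "\<And>n. N \<le> n \<Longrightarrow> ereal r < v (t n)"
    unfolding null_seqs_iff eventually_sequentially by blast
  have "ereal r < v (t m - t n)" if "N \<le> m" "N \<le> n" for m n
    using v_add_gt[of "ereal r" "t m" "- t n"] N that by simp
  then show "\<exists>N. \<forall>m\<ge>N. \<forall>n\<ge>N. ereal r < v (t m - t n)" by blast
qed

lemma ideal_null_seqs: "ideal (null_seqs v) (cauchy_ring v)"
  unfolding cauchy_ring_eq ideal_ring_on_iff[OF subring_v_Cauchy]
proof (intro conjI ballI)
  show "0 \<in> null_seqs v" by (simp add: null_seqs_iff)
  show "t + u \<in> null_seqs v" if "t \<in> null_seqs v" "u \<in> null_seqs v" for t u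
    unfolding null_seqs_iff
  proof
    fix r
    from that have "\<forall>\<^sub>F n in sequentially. ereal r < v (t n)" "\<forall>\<^sub>F n in sequentially. ereal r < v (u n)"
      by (auto simp: null_seqs_iff)
    then show "\<forall>\<^sub>F n in sequentially. ereal r < v ((t + u) n)"
      by eventually_elim (simp add: v_add_gt)
  qed
  show "t * u \<in> null_seqs v" if "t \<in> {t. v_Cauchy v t}" "u \<in> null_seqs v" for t u
    unfolding null_seqs_iff
  proof
    fix r
    obtain b where "\<forall>\<^sub>F n in sequentially. ereal b \<le> v (t n)" using v_Cauchy_bounded \<open>t \<in> _\<close> by blast
    moreover have "\<forall>\<^sub>F n in sequentially. ereal (r - b) < v (u n)" using that(2) by (simp add: null_seqs_iff)
    ultimately show "\<forall>\<^sub>F n in sequentially. ereal r < v ((t * u) n)"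
      by eventually_elim (simp add: v_mult_gt)
  qed
qed (auto simp: null_seqs_Cauchy)

abbreviation null_coset :: "(nat \<Rightarrow> 'a) \<Rightarrow> (nat \<Rightarrow> 'a) set" where
  "null_coset t \<equiv> null_seqs v +>\<^bsub>cauchy_ring v\<^esub> t"

lemma mem_null_coset: "u \<in> null_coset t \<longleftrightarrow> u - t \<in> null_seqs v"
proof
  assume "u \<in> null_coset t"
  then show "u - t \<in> null_seqs v"
    unfolding a_r_coset_def' by (auto simp: cauchy_ring_eq)
next
  assume "u - t \<in> null_seqs v"
  then show "u \<in> null_coset t"
    unfolding a_r_coset_def' by (auto simp: cauchy_ring_eq intro!: bexI[of _ "u - t"])
qed

lemma ring_hom_null_coset: "ring_hom_cring (cauchy_ring v) (completion v) null_coset"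
  unfolding completion_def
  by (rule ideal.rcos_ring_hom_cring[OF ideal_null_seqs])
    (unfold cauchy_ring_eq, rule cring_ring_on[OF subring_v_Cauchy])

lemma null_coset_eq_zero_iff:
  assumes "v_Cauchy v t"
  shows "null_coset t = \<zero>\<^bsub>completion v\<^esub> \<longleftrightarrow> t \<in> null_seqs v"
proof -
  interpret ideal "null_seqs v" "cauchy_ring v" by (rule ideal_null_seqs)
  have "t \<in> carrier (cauchy_ring v)" using assms by (simp add: cauchy_ring_eq)
  then have "null_coset t = null_seqs v \<longleftrightarrow> t \<in> null_seqs v"
    using a_rcos_self[of t] a_rcos_const[of t] by auto
  then show ?thesis by (simp add: completion_def FactRing_def)
qed

text \<open>If \<open>t\<close> is not null, some bound \<open>r\<close> is not exceeded by
  infinitely many terms, while late differences have value above \<open>r\<close>. One such late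
  term then fixes the value of all later ones.\<close>

lemma v_Cauchy_limit:
  assumes "v_Cauchy v t"
  shows "\<exists>l. (\<lambda>n. v (t n)) \<longlonglongrightarrow> l"
proof (cases "t \<in> null_seqs v")
  case True
  then show ?thesis by (auto simp: null_seqs_def)
next
  case False
  then obtain r where r: "\<not> (\<forall>\<^sub>F n in sequentially. ereal r < v (t n))" by (auto simp: null_seqs_iff)
  obtain N where N: "\<And>m n. N \<le> m \<Longrightarrow> N \<le> n \<Longrightarrow> ereal r < v (t m - t n)"
    using v_CauchyD[OF assms, of r] by blast
  from r obtain n where n: "N \<le> n" "v (t n) \<le> ereal r"
    by (auto simp: eventually_sequentially not_less)
  have "v (t m) = v (t n)" if "N \<le> m" for m
    using v_add_eq[of "t n" "t m - t n"] n N[OF that n(1)] by simp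
  then have "\<forall>\<^sub>F m in sequentially. v (t m) = v (t n)" unfolding eventually_sequentially by blast
  then show ?thesis by (intro exI tendsto_eventually)
qed

text \<open>Independence of the representative: a null sequence is eventually dominated when the
  limit is finite, and when it is \<infinity> the whole coset consists of null sequences.\<close>

lemma completion_val_null_coset:
  assumes "(\<lambda>n. v (t n)) \<longlonglongrightarrow> l"
  shows "completion_val v (null_coset t) = l"
  unfolding completion_val_def
proof (rule the_equality)
  show "\<forall>u\<in>null_coset t. (\<lambda>n. v (u n)) \<longlonglongrightarrow> l"
  proof
    fix u assume "u \<in> null_coset t"
    then have null: "u - t \<in> null_seqs v" by (simp add: mem_null_coset)
    show "(\<lambda>n. v (u n)) \<longlonglongrightarrow> l"
    proof (cases "l = \<infinity>")
      case True
      have "(u - t) + t \<in> null_seqs v"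
        using null assms True additive_subgroup.a_closed[OF ideal.axioms(1)[OF ideal_null_seqs], of "u - t" t]
        by (simp add: cauchy_ring_eq null_seqs_def)
      with True show ?thesis by (simp add: null_seqs_def)
    next
      case False
      then obtain r :: real where "l < ereal r" using less_PInf_Ex_of_nat[of l] by auto
      with assms have "\<forall>\<^sub>F n in sequentially. v (t n) < ereal r" by (auto dest: order_tendstoD(2))
      moreover have "\<forall>\<^sub>F n in sequentially. ereal r < v ((u - t) n)" using null by (simp add: null_seqs_iff)
      ultimately have "\<forall>\<^sub>F n in sequentially. v (t n) = v (u n)"
      proof eventually_elim
        case (elim n)
        then show ?case using v_add_eq[of "t n" "(u - t) n"] by simp
      qed
      with assms show ?thesis by (rule Lim_transform_eventually)
    qed
  qed
next
  fix c assume "\<forall>u\<in>null_coset t. (\<lambda>n. v (u n)) \<longlonglongrightarrow> c"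
  moreover have "t \<in> null_coset t" by (simp add: mem_null_coset null_seqs_iff)
  ultimately show "c = l" using assms LIMSEQ_unique by blast
qed

text \<open>The coset map is a ring homomorphism, so evaluation in the completion can be carried out
  termwise on a representative.\<close>

lemma completion_poly_null_coset:
  assumes "v_Cauchy v t"
  shows "completion_poly v p (null_coset t) = null_coset (\<lambda>n. poly p (t n))" (is ?eq)
    and "v_Cauchy v (\<lambda>n. poly p (t n))"
proof -
  interpret h: ring_hom_cring "cauchy_ring v" "completion v" null_coset by (rule ring_hom_null_coset)
  define g where "g i = (\<lambda>_. Polynomial.coeff p i) * t ^ i" for i
  have power: "(t ^ i) n = t n ^ i" for i n by (induction i) simp_all
  have t_power: "v_Cauchy v (t ^ i)" for i
    using subring_ring_onD(7)[OF subring_v_Cauchy, of t i] assms by simp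
  have g: "g i \<in> carrier (cauchy_ring v)" for i
    by (simp add: g_def cauchy_ring_eq v_Cauchy_mult v_Cauchy_const t_power)
  have "finsum (cauchy_ring v) g {..Polynomial.degree p} = sum g {..Polynomial.degree p}"
    using g unfolding cauchy_ring_eq by (intro finsum_ring_on subring_v_Cauchy) auto
  also have "\<dots> = (\<lambda>n. poly p (t n))"
  proof
    fix n
    have "sum g I n = (\<Sum>i\<in>I. Polynomial.coeff p i * t n ^ i)" if "finite I" for I
      using that by (induction I rule: finite_induct) (simp_all add: g_def power)
    then show "sum g {..Polynomial.degree p} n = poly p (t n)" by (simp add: poly_altdef)
  qed
  finally have sum: "finsum (cauchy_ring v) g {..Polynomial.degree p} = (\<lambda>n. poly p (t n))" .
  then show "v_Cauchy v (\<lambda>n. poly p (t n))"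
    using h.R.finsum_closed[of g "{..Polynomial.degree p}"] g by (simp add: cauchy_ring_eq)
  have "null_coset (g i) = completion_embed v (Polynomial.coeff p i) \<otimes>\<^bsub>completion v\<^esub>
      (null_coset t [^]\<^bsub>completion v\<^esub> i)" for i
  proof -
    have "null_coset (t [^]\<^bsub>cauchy_ring v\<^esub> i) = null_coset t [^]\<^bsub>completion v\<^esub> i"
      using assms by (intro h.hom_pow) (simp add: cauchy_ring_eq)
    then have "null_coset (t ^ i) = null_coset t [^]\<^bsub>completion v\<^esub> i"
      by (simp add: cauchy_ring_eq nat_pow_ring_on)
    then show ?thesis
      using h.hom_mult[of "\<lambda>_. Polynomial.coeff p i" "t ^ i"] t_power
      by (simp add: g_def completion_embed_def cauchy_ring_eq v_Cauchy_const)
  qed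
  then have "completion_poly v p (null_coset t) =
      finsum (completion v) (null_coset \<circ> g) {..Polynomial.degree p}"
    by (simp add: completion_poly_def comp_def)
  also have "\<dots> = null_coset (finsum (cauchy_ring v) g {..Polynomial.degree p})"
    using g by (intro h.hom_finsum[symmetric]) auto
  finally show ?eq unfolding sum .
qed

end

section \<open>The pseudo-limit for infinite breadth and its minimal polynomial\<close>

context key_polynomial_infinite
begin

lemma v_Cauchy_s: "v_Cauchy v s"
  unfolding v_Cauchy_def
proof
  fix r :: real
  have "\<forall>\<^sub>F n in sequentially. r < d n" using d_at_top by (simp add: filterlim_at_top_dense)
  then obtain N where N: "\<And>n. N \<le> n \<Longrightarrow> r < d n" unfolding eventually_sequentially by blast
  have less: "ereal r < v (s m - s n)" if "N \<le> n" "n < m" for m n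
    using N[OF that(1)] v_seq_diff[OF that(2)] by simp
  have "ereal r < v (s m - s n)" if "N \<le> m" "N \<le> n" for m n
  proof (cases m n rule: linorder_cases)
    case less
    then show ?thesis using that \<open>\<And>n m. N \<le> n \<Longrightarrow> n < m \<Longrightarrow> _\<close> v_diff_commute[of "s m" "s n"] by simp
  qed (use that less in auto)
  then show "\<exists>N. \<forall>m\<ge>N. \<forall>n\<ge>N. ereal r < v (s m - s n)" by blast
qed

text \<open>Let \<open>t\<close> represent \<open>\<alpha>\<close>. Since the values of
  \<open>\<alpha> - s n\<close> strictly increase, each of them equals the value \<open>d n\<close>
  of \<open>s (n + 1) - s n\<close>. As \<open>d\<close> is unbounded, \<open>t - s\<close> is a
  null sequence.\<close>

lemma pseudo_limit_unique:
  assumes "completion_pseudo_limit v s \<alpha>"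
  shows "\<alpha> = null_coset s"
proof -
  interpret I: ideal "null_seqs v" "cauchy_ring v" by (rule ideal_null_seqs)
  interpret h: ring_hom_cring "cauchy_ring v" "completion v" null_coset by (rule ring_hom_null_coset)
  from assms obtain t where t: "v_Cauchy v t" and \<alpha>: "\<alpha> = null_coset t"
    by (auto simp: completion_pseudo_limit_def completion_def FactRing_def A_RCOSETS_def' cauchy_ring_eq)
  have t_diff: "v_Cauchy v (t - (\<lambda>_. c))" for c
    using v_Cauchy_add[OF t v_Cauchy_uminus[OF v_Cauchy_const]] by simp
  have "\<exists>l. \<forall>n. (\<lambda>m. v (t m - s n)) \<longlonglongrightarrow> l n"
    using v_Cauchy_limit[OF t_diff] by (intro choice) simp
  then obtain l where l: "\<And>n. (\<lambda>m. v (t m - s n)) \<longlonglongrightarrow> l n" by blast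
  have "\<alpha> \<ominus>\<^bsub>completion v\<^esub> completion_embed v c = null_coset (t - (\<lambda>_. c))" for c
  proof -
    have carrier: "t \<in> carrier (cauchy_ring v)" "(\<lambda>_. c) \<in> carrier (cauchy_ring v)"
      using t by (simp_all add: cauchy_ring_eq v_Cauchy_const)
    have "t - (\<lambda>_. c) = t \<oplus>\<^bsub>cauchy_ring v\<^esub> (\<ominus>\<^bsub>cauchy_ring v\<^esub> (\<lambda>_. c))"
      unfolding cauchy_ring_eq by (simp add: a_inv_ring_on[OF subring_v_Cauchy] v_Cauchy_const)
    then have "null_coset (t - (\<lambda>_. c)) = null_coset t \<oplus>\<^bsub>completion v\<^esub>
        (\<ominus>\<^bsub>completion v\<^esub> null_coset (\<lambda>_. c))"
      using carrier by simp
    also have "\<dots> = \<alpha> \<ominus>\<^bsub>completion v\<^esub> completion_embed v c"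
      by (simp add: a_minus_def \<alpha> completion_embed_def)
    finally show ?thesis ..
  qed
  then have "completion_val v (\<alpha> \<ominus>\<^bsub>completion v\<^esub> completion_embed v (s n)) = l n" for n
    using completion_val_null_coset[of "t - (\<lambda>_. s n)" "l n"] l by simp
  with assms have inc: "l n < l (n + 1)" for n by (simp add: completion_pseudo_limit_def)
  have eq_d: "\<forall>\<^sub>F m in sequentially. v (t m - s n) = ereal (d n)" for n
  proof -
    \<comment> \<open>A bound strictly between the two limits turns their order into a strict
      inequality between the values themselves for all large \<open>m\<close>.\<close>
    obtain r where r: "l n < r" "r < l (n + 1)" using dense[OF inc] by blast
    from order_tendstoD(2)[OF l r(1)] order_tendstoD(1)[OF l r(2)] show ?thesis
    proof eventually_elim
      case (elim m)
      then have "v (t m - s n) < v (- (t m - s (n + 1)))"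
        unfolding v_minus by (rule less_trans)
      then have "v ((t m - s n) + - (t m - s (n + 1))) = v (t m - s n)" by (rule v_add_eq)
      then show ?case using v_step[of n] by simp
    qed
  qed
  have "t - s \<in> null_seqs v"
    unfolding null_seqs_iff
  proof
    fix r
    obtain N where N: "\<And>m n. N \<le> m \<Longrightarrow> N \<le> n \<Longrightarrow> ereal r < v (t m - t n)"
      using v_CauchyD[OF t, of r] by blast
    have "\<forall>\<^sub>F n in sequentially. r < d n" using d_at_top by (simp add: filterlim_at_top_dense)
    with eventually_ge_at_top[of N] show "\<forall>\<^sub>F n in sequentially. ereal r < v ((t - s) n)"
    proof eventually_elim
      case (elim n)
      \<comment> \<open>How large \<open>m\<close> must be in \<open>eq_d\<close> depends on
        \<open>n\<close>, so \<open>t n - s n\<close> is estimated by a detour through a later term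
        \<open>t m\<close>, with the Cauchy property controlling \<open>t n - t m\<close>.\<close>
      from eq_d[of n] eventually_ge_at_top[of N] have "\<forall>\<^sub>F m in sequentially. v (t m - s n) = ereal (d n) \<and> N \<le> m"
        by eventually_elim simp
      then obtain m where m: "v (t m - s n) = ereal (d n)" "N \<le> m"
        using eventually_happens'[OF sequentially_bot] by blast
      have "ereal r < v ((t n - t m) + (t m - s n))"
        using N[OF elim(1) m(2)] m(1) elim(2) by (intro v_add_gt) auto
      then show ?case by simp
    qed
  qed
  then have "t \<in> null_coset s" by (simp add: mem_null_coset)
  moreover have "s \<in> carrier (cauchy_ring v)" using v_Cauchy_s by (simp add: cauchy_ring_eq)
  ultimately show ?thesis
    unfolding \<alpha> using I.a_repr_independence[OF _ _ I.a_subgroup] by blast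
qed

text \<open>The values \<open>c + k * d n\<close> of \<open>p\<close> along \<open>s\<close> tend to
  infinity exactly if \<open>k > 0\<close>. Vanishing at the limit thus becomes positivity of the
  slope, and the minimal polynomial becomes a polynomial of least degree with positive
  slope.\<close>

lemma completion_poly_eq_zero_iff:
  "completion_poly v p (null_coset s) = \<zero>\<^bsub>completion v\<^esub> \<longleftrightarrow> 0 < slope (of_poly p)"
proof (cases "p = 0")
  case True
  then show ?thesis
    unfolding completion_poly_null_coset(1)[OF v_Cauchy_s]
      null_coset_eq_zero_iff[OF completion_poly_null_coset(2)[OF v_Cauchy_s]]
    by (simp add: null_seqs_iff fract_collapse)
next
  case False
  then have "of_poly p \<noteq> 0" by (simp add: Zero_fract_def eq_fract)
  then obtain c k where a: "asym (of_poly p) c k" using exists_asym by blast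
  have "(\<lambda>n. poly p (s n)) \<in> null_seqs v \<longleftrightarrow> 0 < k"
  proof
    assume "0 < k"
    then have at_top: "filterlim (\<lambda>n. c + of_int k * d n) at_top sequentially" by (intro line_at_top) simp
    show "(\<lambda>n. poly p (s n)) \<in> null_seqs v"
      unfolding null_seqs_iff
    proof
      fix r
      have "\<forall>\<^sub>F n in sequentially. r < c + of_int k * d n" using at_top by (simp add: filterlim_at_top_dense)
      with a[unfolded asym_def val_poly] show "\<forall>\<^sub>F n in sequentially. ereal r < v (poly p (s n))"
        by eventually_elim simp
    qed
  next
    assume null: "(\<lambda>n. poly p (s n)) \<in> null_seqs v"
    show "0 < k"
    proof (rule ccontr)
      assume "\<not> 0 < k"
      with slope_poly_nonneg[of p] slope_asym[OF a] have "k = 0" by simp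
      have "\<forall>\<^sub>F n in sequentially. ereal c < v (poly p (s n))" using null by (simp add: null_seqs_iff)
      with a[unfolded asym_def val_poly] have "\<forall>\<^sub>F n in sequentially. False"
        by eventually_elim (simp add: \<open>k = 0\<close>)
      then show False by simp
    qed
  qed
  then show ?thesis
    unfolding completion_poly_null_coset(1)[OF v_Cauchy_s]
      null_coset_eq_zero_iff[OF completion_poly_null_coset(2)[OF v_Cauchy_s]]
    by (simp add: slope_asym[OF a])
qed

lemma minimal_polynomial_localization:
  assumes "completion_pseudo_limit v s \<alpha>" "is_minimal_polynomial v \<alpha> p"
  shows "poly_localization p = valuation_ring slope"
proof (rule poly_localization_eq)
  note * = assms(2)[unfolded is_minimal_polynomial_def pseudo_limit_unique[OF assms(1)]
      completion_poly_eq_zero_iff]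
  from * show "p \<noteq> 0" "0 < slope (of_poly p)" by auto
  show "Polynomial.degree p \<le> Polynomial.degree f" if "f \<noteq> 0" "0 < slope (of_poly f)" for f
    using * that by blast
qed

end

context pseudo_convergent_sequence
begin

lemma of_poly_smult: "of_poly (Polynomial.smult c f) = const_fract c * of_poly f"
  by (simp add: const_fract_def)

lemma of_poly_power: "of_poly (f ^ j) = of_poly f ^ j"
proof (induction j)
  case (Suc j)
  have "of_poly (f ^ Suc j) = of_poly f * of_poly (f ^ j)" by simp
  with Suc show ?case by simp
qed (simp add: One_fract_def)

text \<open>Monotonicity of \<open>d\<close> ensures that the \<open>lim\<close> in
  \<open>breadth\<close> is an actual limit, namely the supremum.\<close>

lemma tendsto_breadth: "(\<lambda>n. ereal (d n)) \<longlonglongrightarrow> breadth v s"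
proof -
  have "incseq (\<lambda>n. ereal (d n))"
    using strict_mono_mono[OF strict_mono_d] by (auto simp: incseq_def mono_def)
  then have "(\<lambda>n. ereal (d n)) \<longlonglongrightarrow> (SUP n. ereal (d n))" by (rule LIMSEQ_SUP)
  moreover from limI[OF this] have "breadth v s = (SUP n. ereal (d n))"
    by (simp add: breadth_def v_step)
  ultimately show ?thesis by simp
qed

end

section \<open>Finite breadth\<close>

locale key_polynomial_finite = key_polynomial +
  fixes \<delta> :: real
  assumes d_tendsto: "d \<longlonglongrightarrow> \<delta>"
begin

abbreviation w :: "'a poly fract \<Rightarrow> ereal" where
  "w \<equiv> w_E v s"

lemma tendsto_asym:
  assumes "asym \<phi> c k"
  shows "val \<phi> \<longlonglongrightarrow> ereal (c + of_int k * \<delta>)"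
proof -
  have "(\<lambda>n. ereal (c + of_int k * d n)) \<longlonglongrightarrow> ereal (c + of_int k * \<delta>)"
    by (intro tendsto_intros d_tendsto)
  moreover have "\<forall>\<^sub>F n in sequentially. ereal (c + of_int k * d n) = val \<phi> n"
    using assms unfolding asym_def by eventually_elim simp
  ultimately show ?thesis by (rule Lim_transform_eventually)
qed

lemma w_asym: "asym \<phi> c k \<Longrightarrow> w \<phi> = ereal (c + of_int k * \<delta>)"
  by (intro tendsto_w_E tendsto_asym)

sublocale w: rank_one_valuation w
  using exists_asym tendsto_asym by (intro rank_one_valuation_w_E) blast

lemma w_const: "w (const_fract x) = v x"
proof -
  have "val (const_fract x) = (\<lambda>_. v x)" by (simp add: fun_eq_iff val_const)
  then show ?thesis by (intro tendsto_w_E) simp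
qed

lemma d_less: "d n < \<delta>"
proof -
  have "d (Suc n) \<le> \<delta>"
    using strict_mono_mono[OF strict_mono_d] d_tendsto by (intro incseq_le)
  moreover have "d n < d (Suc n)" by simp
  ultimately show ?thesis by (rule less_le_trans[rotated])
qed

lemma V_E_subset_W_E: "V_E v s \<subseteq> valuation_ring w"
proof
  fix \<phi> assume \<phi>: "\<phi> \<in> V_E v s"
  show "\<phi> \<in> valuation_ring w"
  proof (cases "\<phi> = 0")
    case False
    then obtain c k where "asym \<phi> c k" using exists_asym by blast
    with tendsto_asym w_asym have "val \<phi> \<longlonglongrightarrow> w \<phi>" by metis
    then show ?thesis
      using \<phi> unfolding V_E_iff valuation_ring_def by (auto intro: tendsto_lowerbound)
  qed (simp add: valuation_ring_def)
qed

lemma w_pos_subset: "{\<phi>. 0 < w \<phi>} \<subseteq> m_E"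
proof
  fix \<phi> assume \<phi>: "\<phi> \<in> {\<phi>. 0 < w \<phi>}"
  show "\<phi> \<in> m_E"
  proof (cases "\<phi> = 0")
    case False
    then obtain c k where "asym \<phi> c k" using exists_asym by blast
    with tendsto_asym w_asym have "val \<phi> \<longlonglongrightarrow> w \<phi>" by metis
    with \<phi> show ?thesis by (auto simp: m_E_def dest: order_tendstoD(1))
  qed (simp add: zero_in_m_E)
qed

text \<open>Both \<open>c\<close> and \<open>- c\<close> are in the value group. With
  \<open>k \<noteq> 0\<close> the equation would exhibit a positive multiple of \<delta>
  there.\<close>

lemma not_torsion_slope:
  assumes "\<not> torsion_over (value_group v) \<delta>" "asym \<phi> c k" "c + of_int k * \<delta> = 0"
  shows "c = 0 \<and> k = 0"
proof -
  have "k = 0"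
  proof (rule ccontr)
    assume "k \<noteq> 0"
    have "c \<in> value_group v" "- c \<in> value_group v"
      using assms(2) asym_inverse asym_value_group by blast+
    moreover have "of_nat (nat \<bar>k\<bar>) * \<delta> = c \<or> of_nat (nat \<bar>k\<bar>) * \<delta> = - c"
      using assms(3) by (auto simp: abs_if)
    ultimately have "of_nat (nat \<bar>k\<bar>) * \<delta> \<in> value_group v" by auto
    moreover have "1 \<le> nat \<bar>k\<bar>" using \<open>k \<noteq> 0\<close> by simp
    ultimately show False using assms(1) unfolding torsion_over_def by blast
  qed
  with assms(3) show ?thesis by simp
qed

text \<open>A power of \<open>q\<close> is normalised by a constant so that its limit value is 0. As
  \<open>d n < \<delta>\<close> and the slope is positive, its values approach 0 strictly from
  below, so its inverse has positive values along the sequence. Taking a polynomial here settles the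
  comparison on \<open>K[X]\<close> too.\<close>

lemma torsion_polynomial:
  assumes "torsion_over (value_group v) \<delta>"
  shows "\<exists>f. w (of_poly f) = 0 \<and> inverse (of_poly f) \<in> m_E"
proof -
  from assms obtain j y where j: "1 \<le> j" and y: "v y = ereal (of_nat j * \<delta>)"
    unfolding torsion_over_def value_group_def by auto
  obtain \<gamma> k where q: "1 \<le> k" "asym (of_poly q) \<gamma> k" using asym_q by blast
  then obtain z where z: "v z = ereal \<gamma>" using asym_value_group unfolding value_group_def by blast
  \<comment> \<open>The exponent \<open>j\<close> makes the limit value
    \<open>j * \<gamma> + k * (j * \<delta>)\<close> of \<open>q ^ j\<close> an element of the value
    group: \<open>v z = \<gamma>\<close> and \<open>v y = j * \<delta>\<close>.\<close>
  define a where "a = z ^ j * y ^ nat k"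
  define c where "c = - (of_nat j * \<gamma> + of_int k * (of_nat j * \<delta>))"
  have va: "v a = ereal (- c)"
    using q(1) v_power_real[OF z, of j] v_power_real[OF y, of "nat k"] by (simp add: a_def c_def v_mult)
  then have "a \<noteq> 0" by auto
  with va have "v (inverse a) = ereal c" by (simp add: v_inverse)
  define \<phi> where "\<phi> = of_poly (Polynomial.smult (inverse a) (q ^ j))"
  have \<phi>: "asym \<phi> (c + of_nat j * \<gamma>) (0 + of_nat j * k)"
    unfolding \<phi>_def of_poly_smult of_poly_power
    by (intro asym_mult asym_power asym_const \<open>v (inverse a) = ereal c\<close> q)
  have "w \<phi> = 0" using w_asym[OF \<phi>] by (simp add: c_def algebra_simps)
  moreover have "inverse \<phi> \<in> m_E"
  proof -
    have neg: "c + of_nat j * \<gamma> + of_int (of_nat j * k) * d n < 0" for n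
    proof -
      have "real_of_int (of_nat j * k) * d n < real_of_int (of_nat j * k) * \<delta>"
        using j q(1) d_less by simp
      then show ?thesis by (simp add: c_def algebra_simps)
    qed
    have "\<forall>\<^sub>F n in sequentially. 0 < val (inverse \<phi>) n"
      using asym_inverse[OF \<phi>] unfolding asym_def
    proof eventually_elim
      case (elim n)
      then show ?case using neg[of n] by simp
    qed
    then show ?thesis by (simp add: m_E_def)
  qed
  ultimately show ?thesis unfolding \<phi>_def by blast
qed

text \<open>A member of \<open>m_E\<close> with limit value 0 would lie on a line with
  \<open>c + k * \<delta> = 0\<close>; without torsion this is the zero line, against positivity
  along the sequence.\<close>

lemma not_torsion_m_E:
  assumes "\<not> torsion_over (value_group v) \<delta>"
  shows "m_E = {\<phi>. 0 < w \<phi>}"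
proof
  show "m_E \<subseteq> {\<phi>. 0 < w \<phi>}"
  proof
    fix \<phi> assume \<phi>: "\<phi> \<in> m_E"
    show "\<phi> \<in> {\<phi>. 0 < w \<phi>}"
    proof (rule ccontr)
      assume *: "\<phi> \<notin> {\<phi>. 0 < w \<phi>}"
      with \<phi> m_E_subset V_E_subset_W_E have "w \<phi> = 0" by (force simp: valuation_ring_def)
      then have "\<phi> \<noteq> 0" by auto
      then obtain c k where a: "asym \<phi> c k" using exists_asym by blast
      with \<open>w \<phi> = 0\<close> w_asym have "c + of_int k * \<delta> = 0" by (simp add: zero_ereal_def)
      with not_torsion_slope[OF assms a] a have "\<forall>\<^sub>F n in sequentially. val \<phi> n = 0"
        by (simp add: asym_0_0_iff)
      with \<phi>[unfolded m_E_def mem_Collect_eq] have "\<forall>\<^sub>F n in sequentially. False"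
        by eventually_elim simp
      then show False by simp
    qed
  qed
qed (rule w_pos_subset)

lemma not_torsion_unit:
  assumes "\<not> torsion_over (value_group v) \<delta>" "w \<phi> = 0"
  shows "asym \<phi> 0 0"
proof -
  from assms(2) have "\<phi> \<noteq> 0" by auto
  then obtain c k where a: "asym \<phi> c k" using exists_asym by blast
  with assms(2) w_asym have "c + of_int k * \<delta> = 0" by (simp add: zero_ereal_def)
  with not_torsion_slope[OF assms(1) a] a show ?thesis by simp
qed

lemma not_torsion_V_E:
  assumes "\<not> torsion_over (value_group v) \<delta>"
  shows "V_E v s = W_E v s"
proof
  show "W_E v s \<subseteq> V_E v s"
  proof
    fix \<phi> assume "\<phi> \<in> W_E v s"
    then consider "0 < w \<phi>" | "w \<phi> = 0" by (force simp: W_E_def)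
    then show "\<phi> \<in> V_E v s"
      using w_pos_subset m_E_subset V_E_constant_iff[OF not_torsion_unit[OF assms]] by cases auto
  qed
qed (use V_E_subset_W_E W_E_eq in simp)

text \<open>The polynomial \<open>f\<close> above is in \<open>W_E v s\<close>. It is not in
  \<open>V_E v s\<close>, since multiplying by its inverse would put 1 into the ideal
  \<open>m_E\<close>.\<close>

lemma torsion_V_E:
  assumes "torsion_over (value_group v) \<delta>"
  shows "V_E v s \<inter> polynomials \<noteq> W_E v s \<inter> polynomials"
proof -
  obtain f where f: "w (of_poly f) = 0" "inverse (of_poly f) \<in> m_E"
    using torsion_polynomial[OF assms] by blast
  then have "of_poly f \<noteq> 0" by auto
  have "of_poly f \<notin> V_E v s"
  proof
    assume "of_poly f \<in> V_E v s"
    with f have "of_poly f * inverse (of_poly f) \<in> m_E" by (intro m_E_mult)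
    with \<open>of_poly f \<noteq> 0\<close> one_notin_m_E show False by (metis right_inverse)
  qed
  moreover have "of_poly f \<in> W_E v s" using f by (simp add: W_E_def)
  moreover have "of_poly f \<in> polynomials" by (simp add: polynomials_def)
  ultimately show ?thesis by blast
qed

text \<open>The inverse of \<open>f\<close> lies in \<open>m_E\<close> but has limit value 0. It
  therefore separates \<open>m_E\<close> from the prime of positive limit values, and a chain of
  three primes results.\<close>

lemma torsion_rank:
  assumes "torsion_over (value_group v) \<delta>"
  shows "rank (V_E v s) \<noteq> 1"
proof -
  obtain f where f: "w (of_poly f) = 0" "inverse (of_poly f) \<in> m_E"
    using torsion_polynomial[OF assms] by blast
  then have "of_poly f \<noteq> 0" by auto
  with f(1) have "w (inverse (of_poly f)) = 0" using w.v_inverse[of "of_poly f"] by simp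
  with f(2) w_pos_subset have w_m: "{\<phi>. 0 < w \<phi>} \<subset> m_E" by force
  define P where "P i = (if i = 0 then {0} else if i = 1 then {\<phi>. 0 < w \<phi>} else m_E)" for i :: nat
  have "enat 2 \<le> krull_dim (ring_on (V_E v s))"
  proof (rule krull_dim_ge[where P = P])
    fix i :: nat
    have "primeideal {0} (ring_on (V_E v s))"
      unfolding primeideal_ring_on_iff[OF subring_V_E] by (auto simp: V_E_iff val_0)
    moreover have "primeideal {\<phi>. 0 < w \<phi>} (ring_on (V_E v s))"
      using w.primeideal_positive[OF subring_V_E V_E_subset_W_E] w_pos_subset m_E_subset by blast
    moreover have "primeideal m_E (ring_on (V_E v s))"
      using exists_asym by (rule primeideal_m_E)
    ultimately show "primeideal (P i) (ring_on (V_E v s))" by (simp add: P_def)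
    assume "i < 2"
    moreover have "{0} \<subset> {\<phi>. 0 < w \<phi>}" using w.exists_pos by auto
    ultimately show "P i \<subset> P (Suc i)" using w_m by (cases i) (auto simp: P_def)
  qed
  then show ?thesis by (auto simp: rank_def one_enat_def)
qed

section \<open>The residue field of \<open>W_E v s\<close> over that of \<open>v\<close>\<close>

abbreviation residue :: "'a poly fract \<Rightarrow> 'a poly fract set" where
  "residue \<phi> \<equiv> maximal_ideal (W_E v s) +>\<^bsub>ring_on (W_E v s)\<^esub> \<phi>"

lemma maximal_ideal_W_E: "maximal_ideal (W_E v s) = {\<phi>. 0 < w \<phi>}"
  unfolding W_E_eq by (rule w.maximal_ideal_valuation_ring)

lemma cring_W_E: "cring (ring_on (W_E v s))"
  unfolding W_E_eq by (rule cring_ring_on[OF w.subring_valuation_ring])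

lemma primeideal_maximal_ideal: "primeideal (maximal_ideal (W_E v s)) (ring_on (W_E v s))"
  unfolding maximal_ideal_W_E unfolding W_E_eq by (simp add: w.primeideal_valuation_ring_iff)

lemma domain_residue_field: "domain (residue_field (W_E v s))"
  unfolding residue_field_def by (rule primeideal.quotient_is_domain[OF primeideal_maximal_ideal])

lemma ring_hom_residue: "ring_hom_cring (ring_on (W_E v s)) (residue_field (W_E v s)) residue"
  unfolding residue_field_def by (rule primeideal.rcos_ring_hom_cring[OF primeideal_maximal_ideal])

lemma carrier_residue_field: "carrier (residue_field (W_E v s)) = residue ` W_E v s"
  by (auto simp: residue_field_def FactRing_def A_RCOSETS_def')

lemma residue_eq_zero_iff:
  assumes "\<phi> \<in> W_E v s"
  shows "residue \<phi> = \<zero>\<^bsub>residue_field (W_E v s)\<^esub> \<longleftrightarrow> 0 < w \<phi>"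
proof -
  interpret primeideal "maximal_ideal (W_E v s)" "ring_on (W_E v s)" by (rule primeideal_maximal_ideal)
  have "residue \<phi> = maximal_ideal (W_E v s) \<longleftrightarrow> \<phi> \<in> maximal_ideal (W_E v s)"
    using a_rcos_self[of \<phi>] a_rcos_const[of \<phi>] assms by auto
  then show ?thesis by (simp add: residue_field_def FactRing_def maximal_ideal_W_E)
qed

lemma const_W_E: "x \<in> valuation_ring v \<Longrightarrow> const_fract x \<in> W_E v s"
  by (simp add: W_E_def valuation_ring_def w_const)

lemma subring_residue_subfield:
  "subring (residue_subfield (valuation_ring v) (W_E v s)) (residue_field (W_E v s))"
proof -
  interpret cring "ring_on (W_E v s)" by (rule cring_W_E)
  interpret h: ring_hom_cring "ring_on (W_E v s)" "residue_field (W_E v s)" residue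
    by (rule ring_hom_residue)
  note V = subring_ring_onD[OF subring_valuation_ring]
  have W: "subring (W_E v s) (ring_on UNIV)" unfolding W_E_eq by (rule w.subring_valuation_ring)
  have "subring (const_fract ` valuation_ring v) (ring_on (W_E v s))"
  proof (rule subringI)
    show "const_fract ` valuation_ring v \<subseteq> carrier (ring_on (W_E v s))" using const_W_E by auto
    show "\<one>\<^bsub>ring_on (W_E v s)\<^esub> \<in> const_fract ` valuation_ring v"
      using V(2) const_1 by (metis image_eqI ring_on_simps(3))
    show "\<ominus>\<^bsub>ring_on (W_E v s)\<^esub> x \<in> const_fract ` valuation_ring v"
      if "x \<in> const_fract ` valuation_ring v" for x
    proof -
      from that obtain c where c: "x = const_fract c" "c \<in> valuation_ring v" by blast
      then have "\<ominus>\<^bsub>ring_on (W_E v s)\<^esub> x = const_fract (- c)"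
        using a_inv_ring_on[OF W] const_W_E by (simp add: const_minus)
      with c V(3) show ?thesis by blast
    qed
  qed (use V in \<open>auto simp flip: const_mult const_add\<close>)
  moreover have "ring_hom_ring (ring_on (W_E v s)) (residue_field (W_E v s)) residue"
    unfolding residue_field_def
    by (rule ideal.rcos_ring_hom_ring[OF primeideal.axioms(1)[OF primeideal_maximal_ideal]])
  ultimately have "subring (residue ` const_fract ` valuation_ring v) (residue_field (W_E v s))"
    by (rule ring_hom_ring.img_is_subring[rotated])
  then show ?thesis by (simp add: residue_subfield_def image_image)
qed

text \<open>The residue extension is even trivial: an element of limit value 0 is a constant times a
  1-unit \<open>u\<close>, and without torsion \<open>u - 1\<close> has positive limit value, so the
  element and the constant have the same residue.\<close>

lemma not_torsion_residually_algebraic: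
  assumes "\<not> torsion_over (value_group v) \<delta>"
  shows "\<not> residually_transcendental (valuation_ring v) (W_E v s)"
proof
  interpret D: domain "residue_field (W_E v s)" by (rule domain_residue_field)
  interpret h: ring_hom_cring "ring_on (W_E v s)" "residue_field (W_E v s)" residue
    by (rule ring_hom_residue)
  assume "residually_transcendental (valuation_ring v) (W_E v s)"
  then obtain \<phi> where \<phi>: "\<phi> \<in> W_E v s"
    and tr: "D.transcendental (residue_subfield (valuation_ring v) (W_E v s)) (residue \<phi>)"
    unfolding residually_transcendental_def carrier_residue_field by blast
  have "\<exists>x. 0 \<le> v x \<and> 0 < w (\<phi> - const_fract x)"
  proof (cases "0 < w \<phi>")
    case True
    then show ?thesis by (intro exI[of _ 0]) (simp add: const_0)
  next
    case False
    with \<phi> have "w \<phi> = 0" by (simp add: W_E_def)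
    with not_torsion_unit[OF assms] obtain x u where x: "v x = 0" "u \<in> U1" "\<phi> = const_fract x * u"
      using residue_of_unit asym_0_0_iff by blast
    have "0 < w (u - 1)" using x(2) not_torsion_m_E[OF assms] by (auto simp: U1_def)
    moreover have "\<phi> - const_fract x = const_fract x * (u - 1)" using x(3) by (simp add: algebra_simps)
    ultimately have "0 < w (\<phi> - const_fract x)" using x(1) by (simp add: w.v_mult w_const)
    with x(1) show ?thesis by (intro exI[of _ x]) simp
  qed
  then obtain x where x: "x \<in> valuation_ring v" "0 < w (\<phi> - const_fract x)"
    by (auto simp: valuation_ring_def)
  then have "\<phi> - const_fract x \<in> W_E v s" by (simp add: W_E_def)
  moreover have "\<phi> = (\<phi> - const_fract x) \<oplus>\<^bsub>ring_on (W_E v s)\<^esub> const_fract x" by simp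
  ultimately have "residue \<phi> = residue (\<phi> - const_fract x) \<oplus>\<^bsub>residue_field (W_E v s)\<^esub> residue (const_fract x)"
    using h.hom_add[of "\<phi> - const_fract x" "const_fract x"] const_W_E[OF x(1)] by simp
  also have "\<dots> = residue (const_fract x)"
    using residue_eq_zero_iff[OF \<open>\<phi> - const_fract x \<in> W_E v s\<close>] x(2)
      h.hom_closed[of "const_fract x"] const_W_E[OF x(1)] by simp
  finally have "residue \<phi> \<in> residue_subfield (valuation_ring v) (W_E v s)"
    using x(1) by (simp add: residue_subfield_def)
  from D.algebraic_self[OF subring_residue_subfield this] tr show False by (simp add: over_def)
qed

text \<open>For \<open>f\<close> as in \<open>torsion_polynomial\<close>, \<open>1 / f\<close> is a non-unit of \<open>V_E v s\<close>, so the residue of \<open>f\<close>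
  cannot be integral over the residue field of \<open>v\<close>.\<close>

lemma torsion_residually_transcendental:
  assumes "torsion_over (value_group v) \<delta>"
  shows "residually_transcendental (valuation_ring v) (W_E v s)"
proof -
  interpret D: domain "residue_field (W_E v s)" by (rule domain_residue_field)
  interpret h: ring_hom_cring "ring_on (W_E v s)" "residue_field (W_E v s)" residue
    by (rule ring_hom_residue)
  let ?K = "residue_subfield (valuation_ring v) (W_E v s)"
  have W: "subring (W_E v s) (ring_on UNIV)" unfolding W_E_eq by (rule w.subring_valuation_ring)
  obtain f where f: "w (of_poly f) = 0" "inverse (of_poly f) \<in> m_E"
    using torsion_polynomial[OF assms] by blast
  define \<phi> where "\<phi> = of_poly f"
  have \<phi>: "\<phi> \<in> W_E v s" "\<phi> \<noteq> 0" using f(1) by (auto simp: \<phi>_def W_E_def)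
  have const_V_E: "const_fract c \<in> V_E v s" if "c \<in> valuation_ring v" for c
    using that by (simp add: V_E_iff val_const valuation_ring_def)
  \<comment> \<open>Polynomials over a HOL-Algebra ring are coefficient lists with the leading
    coefficient first, so a new head \<open>c\<close> contributes the term of degree
    \<open>length p\<close>.\<close>
  have step: "D.eval (residue (const_fract c) # p) (residue \<phi>)
      = residue (const_fract c * \<phi> ^ length p + \<psi>) \<and> const_fract c * \<phi> ^ length p + \<psi> \<in> W_E v s"
    if "c \<in> valuation_ring v" "\<psi> \<in> W_E v s" "D.eval p (residue \<phi>) = residue \<psi>" for c p \<psi>
  proof -
    have pow: "residue (\<phi> ^ n) = residue \<phi> [^]\<^bsub>residue_field (W_E v s)\<^esub> n" for n :: nat
      using h.hom_pow[of \<phi> n] \<phi> by (simp add: nat_pow_ring_on)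
    have "\<phi> ^ length p \<in> W_E v s" using subring_ring_onD(7)[OF W \<phi>(1)] .
    moreover have "const_fract c \<in> W_E v s" using const_W_E that by blast
    ultimately show ?thesis
      using h.hom_mult[of "const_fract c" "\<phi> ^ length p"]
        h.hom_add[of "const_fract c * \<phi> ^ length p" \<psi>] that(2,3) subring_ring_onD(4,5)[OF W]
      by (simp add: pow)
  qed
  \<comment> \<open>The list \<open>p\<close> has degree below \<open>length p\<close>, so division
    by \<open>\<phi> ^ length p\<close> leaves at least one factor \<open>inverse \<phi>\<close>,
    which lies in \<open>m_E\<close>, in every term.\<close>
  have lift: "\<exists>\<psi>\<in>W_E v s. D.eval p (residue \<phi>) = residue \<psi> \<and> \<psi> / \<phi> ^ length p \<in> m_E"
    if "set p \<subseteq> ?K" for p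
    using that
  proof (induction p)
    case Nil
    have "(0 :: 'a poly fract) \<in> W_E v s" by (simp add: W_E_def)
    then show ?case
      using residue_eq_zero_iff[of 0] zero_in_m_E by (intro bexI[of _ 0]) auto
  next
    case (Cons b p)
    then obtain \<psi> where \<psi>: "\<psi> \<in> W_E v s" "D.eval p (residue \<phi>) = residue \<psi>" "\<psi> / \<phi> ^ length p \<in> m_E"
      by auto
    from Cons.prems obtain c where c: "b = residue (const_fract c)" "c \<in> valuation_ring v"
      by (auto simp: residue_subfield_def)
    have "(const_fract c * \<phi> ^ length p + \<psi>) / \<phi> ^ length (b # p)
        = const_fract c * inverse \<phi> + (\<psi> / \<phi> ^ length p) * inverse \<phi>"
      using \<phi>(2) by (simp add: field_simps)
    also have "\<dots> \<in> m_E"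
      using f(2) \<psi>(3) m_E_subset const_V_E[OF c(2)] unfolding \<phi>_def
      by (intro m_E_add m_E_mult) auto
    finally show ?case using step[OF c(2) \<psi>(1,2)] c(1) by blast
  qed
  have "D.transcendental ?K (residue \<phi>)"
  proof (rule ccontr)
    assume "\<not> D.transcendental ?K (residue \<phi>)"
    then have "(D.algebraic over ?K) (residue \<phi>)" by (simp add: over_def)
    moreover have "residue \<phi> \<in> carrier (residue_field (W_E v s))"
      using \<phi> by (simp add: carrier_residue_field)
    ultimately obtain p where "p \<in> carrier (?K [X]\<^bsub>residue_field (W_E v s)\<^esub>)" "p \<noteq> []"
      and zero: "D.eval p (residue \<phi>) = \<zero>\<^bsub>residue_field (W_E v s)\<^esub>"
      using D.algebraicE[OF subring_residue_subfield] by blast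
    \<comment> \<open>The head \<open>b\<close> is the leading coefficient and nonzero by
      normalisation; the contradiction will be that its lift \<open>c\<close> has positive
      value.\<close>
    then obtain b p' where p: "p = b # p'" "b \<noteq> \<zero>\<^bsub>residue_field (W_E v s)\<^esub>" "b \<in> ?K" "set p' \<subseteq> ?K"
      by (cases p) (auto simp: univ_poly_def polynomial_def)
    from p(3) obtain c where c: "b = residue (const_fract c)" "c \<in> valuation_ring v"
      by (auto simp: residue_subfield_def)
    obtain \<psi> where \<psi>: "\<psi> \<in> W_E v s" "D.eval p' (residue \<phi>) = residue \<psi>" "\<psi> / \<phi> ^ length p' \<in> m_E"
      using lift[OF p(4)] by blast
    let ?e = "const_fract c * \<phi> ^ length p' + \<psi>"
    have "?e \<in> m_E"
      using step[OF c(2) \<psi>(1,2)] residue_eq_zero_iff[of ?e] zero w_pos_subset by (auto simp: p(1) c(1))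
    moreover have "inverse \<phi> ^ length p' \<in> V_E v s"
      using f(2) m_E_subset subring_ring_onD(7)[OF subring_V_E] unfolding \<phi>_def by blast
    \<comment> \<open>Dividing the lifted relation by the leading power of \<open>\<phi>\<close>
      isolates \<open>c\<close> up to an element of \<open>m_E\<close>.\<close>
    ultimately have "inverse \<phi> ^ length p' * ?e \<in> m_E" by (intro m_E_mult)
    then have "inverse \<phi> ^ length p' * ?e + - (\<psi> / \<phi> ^ length p') \<in> m_E"
      by (rule m_E_add[OF _ m_E_minus[OF \<psi>(3)]])
    also have "inverse \<phi> ^ length p' * ?e + - (\<psi> / \<phi> ^ length p') = const_fract c"
      using \<phi>(2) by (simp add: field_simps)
    finally have "0 < v c" by (simp add: m_E_def val_const)
    then have "b = \<zero>\<^bsub>residue_field (W_E v s)\<^esub>"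
      using residue_eq_zero_iff[OF const_W_E[OF c(2)]] c(1) by (simp add: w_const)
    with p(2) show False ..
  qed
  then show ?thesis
    unfolding residually_transcendental_def carrier_residue_field using \<phi>(1) by blast
qed

end

theorem theorem4p9:
  fixes v :: "'a::field \<Rightarrow> ereal" and s :: "nat \<Rightarrow> 'a"
  assumes "rank_one_valuation v"
    and "pseudo_convergent v s"
  shows
    "(transcendental_type v s \<longrightarrow>
        V_E v s = W_E v s \<and> rank (V_E v s) = 1)
     \<and>
     (algebraic_type v s \<and> breadth v s = \<infinity> \<longrightarrow>
        rank (V_E v s) = 2 \<and>
        (\<forall>\<alpha> q. completion_pseudo_limit v s \<alpha> \<and> is_minimal_polynomial v \<alpha> q \<longrightarrow>
           {R \<in> overrings (V_E v s). krull_dim (ring_on R) = 1} = {poly_localization q}))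
     \<and>
     (\<forall>\<delta>::real. algebraic_type v s \<and> breadth v s = ereal \<delta> \<longrightarrow>
        (\<not> torsion_over (value_group v) \<delta>
           \<longleftrightarrow> \<not> residually_transcendental (valuation_ring v) (W_E v s)) \<and>
        (\<not> torsion_over (value_group v) \<delta> \<longleftrightarrow> rank (V_E v s) = 1) \<and>
        (\<not> torsion_over (value_group v) \<delta> \<longleftrightarrow> V_E v s = W_E v s) \<and>
        (\<not> torsion_over (value_group v) \<delta>
           \<longleftrightarrow> V_E v s \<inter> polynomials = W_E v s \<inter> polynomials))"
proof (intro conjI allI impI)
  interpret pseudo_convergent_sequence v s
    using assms by (simp add: pseudo_convergent_sequence_def pseudo_convergent_sequence_axioms_def)
  show "V_E v s = W_E v s" "rank (V_E v s) = 1" if "transcendental_type v s"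
    using transcendental_case[OF that] by blast+
  have key: "\<exists>q. key_polynomial v s q" if "algebraic_type v s"
    using exists_key_polynomial algebraic_not_transcendental that by blast
  show "rank (V_E v s) = 2" if "algebraic_type v s \<and> breadth v s = \<infinity>"
  proof -
    from that key obtain q where "key_polynomial v s q" by blast
    then interpret key_polynomial_infinite v s q
      using that tendsto_breadth
      by (intro key_polynomial_infinite.intro key_polynomial_infinite_axioms.intro)
        (simp_all add: tendsto_PInfty_eq_at_top)
    show ?thesis by (rule rank_V_E)
  qed
  show "{R \<in> overrings (V_E v s). krull_dim (ring_on R) = 1} = {poly_localization p}"
    if "algebraic_type v s \<and> breadth v s = \<infinity>"
      "completion_pseudo_limit v s \<alpha> \<and> is_minimal_polynomial v \<alpha> p" for \<alpha> p
  proof -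
    from that key obtain q where "key_polynomial v s q" by blast
    then interpret key_polynomial_infinite v s q
      using that tendsto_breadth
      by (intro key_polynomial_infinite.intro key_polynomial_infinite_axioms.intro)
        (simp_all add: tendsto_PInfty_eq_at_top)
    show ?thesis using one_dimensional_overrings minimal_polynomial_localization[of \<alpha> p] that(2) by simp
  qed
  fix \<delta> :: real
  assume \<delta>: "algebraic_type v s \<and> breadth v s = ereal \<delta>"
  with key obtain q where "key_polynomial v s q" by blast
  then interpret key_polynomial_finite v s q \<delta>
    using \<delta> tendsto_breadth
    by (intro key_polynomial_finite.intro key_polynomial_finite_axioms.intro) simp_all
  show "\<not> torsion_over (value_group v) \<delta> \<longleftrightarrow> \<not> residually_transcendental (valuation_ring v) (W_E v s)"
    using not_torsion_residually_algebraic torsion_residually_transcendental by blast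
  show "\<not> torsion_over (value_group v) \<delta> \<longleftrightarrow> V_E v s = W_E v s"
    and "\<not> torsion_over (value_group v) \<delta> \<longleftrightarrow> V_E v s \<inter> polynomials = W_E v s \<inter> polynomials"
    using not_torsion_V_E torsion_V_E by blast+
  \<comment> \<open>Without torsion \<open>V_E v s\<close> coincides with the valuation ring of the
    rank one valuation \<open>w\<close>; with torsion the longer chain of primes excludes rank
    one.\<close>
  show "\<not> torsion_over (value_group v) \<delta> \<longleftrightarrow> rank (V_E v s) = 1"
    using not_torsion_V_E torsion_rank w.rank_valuation_ring W_E_eq by metis
qed

end
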